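(* Let $H$ be a fixed graph with binary chromatic number $\chi_B(H)=k+1$. Then, as $n\to\infty$, $$\mathrm{Dist}(n,\mathrm{Forb}(n,H))>(1-o(1))\frac{n^2}{4k}.$$
   Context: An edge-operation on a graph is the deletion of an existing edge or the addition of a non-existing edge. For graphs $G,G'$ on the same number of vertices, $\mathrm{Dist}(G,G')=\min\{|E(G)\,\Delta\, E(G'')| : G''\cong G',\ V(G'')=V(G)\}$, i.e. the minimum number of edge-operations needed to transform $G$ into a graph isomorphic to $G'$. For a family $\mathcal H$ of $n$-vertex graphs and an $n$-vertex graph $G$, $\mathrm{Dist}(G,\mathcal H)=\min_{H'\in\mathcal H}\mathrm{Dist}(G,H')$, and $\mathrm{Dist}(n,\mathcal H)=\max\{\mathrm{Dist}(G,\mathcal H): |V(G)|=n\}$. $\mathrm{Forb}(n,H)$ denotes the set of all graphs on $n$ vertices containing no induced subgraph isomorphic to $H$. A clique is a vertex set inducing a complete graph, a coclique is a vertex set inducing an edgeless graph. The binary chromatic number $\chi_B(G)$ of a graph $G$ is the least integer $k+1$ such that for every $c\in\{0,1,\dots,k+1\}$ there exists a partition of $V(G)$ into $c$ cliques and $k+1-c$ cocliques (parts may be empty). *)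

theory Defs
  imports Complex_Main "HOL-Library.Disjoint_Sets" "HOL-Library.Landau_Symbols"
begin

record 'a sgraph =
  verts :: "'a set"
  edges :: "'a set set"

definition simple_graph :: "'a sgraph \<Rightarrow> bool" where
  "simple_graph G \<longleftrightarrow> finite (verts G) \<and> edges G \<subseteq> {e. e \<subseteq> verts G \<and> card e = 2}"

definition graph_iso :: "'a sgraph \<Rightarrow> 'b sgraph \<Rightarrow> bool" where
  "graph_iso G G' \<longleftrightarrow> (\<exists>f. bij_betw f (verts G) (verts G') \<and>
     (\<forall>u\<in>verts G. \<forall>v\<in>verts G. {u, v} \<in> edges G \<longleftrightarrow> {f u, f v} \<in> edges G'))"

definition induced :: "'a sgraph \<Rightarrow> 'a set \<Rightarrow> 'a sgraph" where
  "induced G S = \<lparr>verts = S, edges = {e \<in> edges G. e \<subseteq> S}\<rparr>"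

definition is_clique :: "'a sgraph \<Rightarrow> 'a set \<Rightarrow> bool" where
  "is_clique G S \<longleftrightarrow> S \<subseteq> verts G \<and> (\<forall>u\<in>S. \<forall>v\<in>S. u \<noteq> v \<longrightarrow> {u, v} \<in> edges G)"

definition is_coclique :: "'a sgraph \<Rightarrow> 'a set \<Rightarrow> bool" where
  "is_coclique G S \<longleftrightarrow> S \<subseteq> verts G \<and> (\<forall>u\<in>S. \<forall>v\<in>S. {u, v} \<notin> edges G)"

(* Partitions are indexed families rather than sets of sets, so parts may be empty. *)
definition clique_coclique_partition :: "'a sgraph \<Rightarrow> nat \<Rightarrow> nat \<Rightarrow> bool" where
  "clique_coclique_partition G c d \<longleftrightarrow> (\<exists>P. disjoint_family_on P {..<c + d} \<and>
     (\<Union>i<c + d. P i) = verts G \<and>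
     (\<forall>i<c. is_clique G (P i)) \<and> (\<forall>i\<in>{c..<c + d}. is_coclique G (P i)))"

definition binary_chromatic_number :: "'a sgraph \<Rightarrow> nat" where
  "binary_chromatic_number G =
     (LEAST m. \<forall>c\<in>{0..m}. clique_coclique_partition G c (m - c))"

definition graph_dist :: "'a sgraph \<Rightarrow> 'b sgraph \<Rightarrow> nat" where
  "graph_dist G G' = Min {card (sym_diff (edges G) (edges G'')) | G''.
     simple_graph G'' \<and> graph_iso G'' G' \<and> verts G'' = verts G}"

definition family_dist :: "'a sgraph \<Rightarrow> 'b sgraph set \<Rightarrow> nat" where
  "family_dist G \<H> = Min {graph_dist G H' | H'. H' \<in> \<H>}"

(* Finite graphs are represented, up to isomorphism, by graphs on finite subsets of nat;
   this keeps an n-vertex graph available for every n. *)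
definition max_dist :: "nat \<Rightarrow> nat sgraph set \<Rightarrow> nat" where
  "max_dist n \<H> = Max {family_dist G \<H> | G :: nat sgraph. simple_graph G \<and> card (verts G) = n}"

definition Forb :: "nat \<Rightarrow> 'a sgraph \<Rightarrow> nat sgraph set" where
  "Forb n H = {G. simple_graph G \<and> card (verts G) = n \<and>
     \<not> (\<exists>S\<subseteq>verts G. graph_iso (induced G S) H)}"

text \<open>
  The minima and maxima above range over nonempty finite sets whenever the forbidden graph has
  at least two vertices. The case of a single vertex (binary chromatic number 1) is degenerate:
  then no graph with a vertex avoids it.
\<close>

lemma binary_chromatic_number_exists:
  assumes "simple_graph G"
  shows "\<forall>c\<in>{0..card (verts G)}. clique_coclique_partition G c (card (verts G) - c)"
proof
  fix c assume c: "c \<in> {0..card (verts G)}"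
  have fin: "finite (verts G)" and e: "edges G \<subseteq> {e. e \<subseteq> verts G \<and> card e = 2}"
    using assms by (auto simp: simple_graph_def)
  obtain h where h: "bij_betw h {..<card (verts G)} (verts G)"
    using ex_bij_betw_nat_finite[OF fin] by (auto simp: atLeast0LessThan)
  have ns: "{v} \<notin> edges G" for v using e by auto
  have mem: "h i \<in> verts G" if "i < card (verts G)" for i
    using h that by (auto simp: bij_betw_def)
  have U: "(\<Union>i<card (verts G). {h i}) = verts G"
    using h by (auto simp: bij_betw_def)
  have D: "disjoint_family_on (\<lambda>i. {h i}) {..<card (verts G)}"
    using h by (auto simp: bij_betw_def disjoint_family_on_def inj_on_def)
  show "clique_coclique_partition G c (card (verts G) - c)"
    unfolding clique_coclique_partition_def
  proof (intro exI[of _ "\<lambda>i. {h i}"] conjI)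
    have [simp]: "c + (card (verts G) - c) = card (verts G)" using c by simp
    show "disjoint_family_on (\<lambda>i. {h i}) {..<c + (card (verts G) - c)}" using D by simp
    show "(\<Union>i<c + (card (verts G) - c). {h i}) = verts G" using U by simp
    show "\<forall>i<c. is_clique G {h i}" using c mem by (simp add: is_clique_def)
    show "\<forall>i\<in>{c..<c + (card (verts G) - c)}. is_coclique G {h i}"
      using mem ns by (simp add: is_coclique_def)
  qed
qed

lemma card_sym_diff_edges_le:
  assumes "simple_graph G" "simple_graph G''" "verts G'' = verts G"
  shows "card (sym_diff (edges G) (edges G'')) \<le> card (verts G) choose 2"
proof -
  have fin: "finite (verts G)" using assms by (simp add: simple_graph_def)
  have "sym_diff (edges G) (edges G'') \<subseteq> {e. e \<subseteq> verts G \<and> card e = 2}"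
    using assms by (auto simp: simple_graph_def)
  moreover have "finite {e. e \<subseteq> verts G \<and> card e = 2}" using fin by simp
  ultimately have "card (sym_diff (edges G) (edges G'')) \<le> card {e. e \<subseteq> verts G \<and> card e = 2}"
    by (intro card_mono)
  then show ?thesis by (simp only: n_subsets[OF fin])
qed

lemma graph_dist_finite:
  assumes "simple_graph G"
  shows "finite {card (sym_diff (edges G) (edges G'')) | G''.
     simple_graph G'' \<and> graph_iso G'' G' \<and> verts G'' = verts G}"
  by (rule finite_subset[of _ "{..card (verts G) choose 2}"])
    (use card_sym_diff_edges_le[OF assms] in auto)

lemma graph_dist_nonempty:
  assumes "simple_graph G" "simple_graph G'" "card (verts G) = card (verts G')"
  shows "{card (sym_diff (edges G) (edges G'')) | G''.
     simple_graph G'' \<and> graph_iso G'' G' \<and> verts G'' = verts G} \<noteq> {}"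
proof -
  have fin: "finite (verts G)" "finite (verts G')" using assms by (auto simp: simple_graph_def)
  obtain f where f: "bij_betw f (verts G) (verts G')"
    using finite_same_card_bij[OF fin assms(3)] by auto
  define G'' where "G'' = \<lparr>verts = verts G,
    edges = {e. e \<subseteq> verts G \<and> card e = 2 \<and> f ` e \<in> edges G'}\<rparr>"
  have ns: "{x} \<notin> edges G'" for x using assms(2) by (auto simp: simple_graph_def)
  have "simple_graph G''" using fin by (auto simp: simple_graph_def G''_def)
  moreover have "graph_iso G'' G'"
    unfolding graph_iso_def
  proof (intro exI[of _ f] conjI ballI)
    show "bij_betw f (verts G'') (verts G')" using f by (simp add: G''_def)
    fix u v assume "u \<in> verts G''" "v \<in> verts G''"
    then show "{u, v} \<in> edges G'' \<longleftrightarrow> {f u, f v} \<in> edges G'"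
      using ns by (cases "u = v") (simp_all add: G''_def)
  qed
  ultimately show ?thesis by (auto simp: G''_def)
qed

lemma graph_dist_le:
  assumes "simple_graph G" "simple_graph G'" "card (verts G) = card (verts G')"
  shows "graph_dist G G' \<le> card (verts G) choose 2"
proof -
  have "graph_dist G G' \<in> {card (sym_diff (edges G) (edges G'')) | G''.
     simple_graph G'' \<and> graph_iso G'' G' \<and> verts G'' = verts G}"
    unfolding graph_dist_def
    by (rule Min_in[OF graph_dist_finite[OF assms(1)] graph_dist_nonempty[OF assms]])
  then show ?thesis using card_sym_diff_edges_le[OF assms(1)] by auto
qed

lemma Forb_nonempty:
  assumes "simple_graph H" "card (verts H) \<ge> 2"
  shows "Forb n H \<noteq> {}"
proof -
  let ?E = "\<lparr>verts = {..<n}, edges = {}\<rparr>"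
  let ?K = "\<lparr>verts = {..<n}, edges = {e. e \<subseteq> {..<n} \<and> card e = 2}\<rparr>"
  obtain a b where ab: "a \<in> verts H" "b \<in> verts H" "a \<noteq> b"
    using assms(2) by (metis card_le_Suc0_iff_eq assms(1) simple_graph_def not_less_eq_eq numeral_2_eq_2)
  have sE: "simple_graph ?E" and sK: "simple_graph ?K" by (auto simp: simple_graph_def)
  have pre: "\<exists>u\<in>S. \<exists>v\<in>S. f u = a \<and> f v = b" if "bij_betw f S (verts H)" for f and S :: "nat set"
  proof -
    have "a \<in> f ` S" "b \<in> f ` S" using that ab by (auto simp: bij_betw_def)
    then show ?thesis by blast
  qed
  show ?thesis
  proof (cases "{a, b} \<in> edges H")
    case True
    have "\<not> graph_iso (induced ?E S) H" for S
    proof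
      assume "graph_iso (induced ?E S) H"
      then obtain f where f: "bij_betw f S (verts H)"
        and *: "\<And>u v. u \<in> S \<Longrightarrow> v \<in> S \<Longrightarrow> {f u, f v} \<notin> edges H"
        by (auto simp: graph_iso_def induced_def)
      obtain u v where uv: "u \<in> S" "v \<in> S" "f u = a" "f v = b" using pre[OF f] by auto
      then show False using *[of u v] True by simp
    qed
    then have "?E \<in> Forb n H" using sE by (auto simp: Forb_def)
    then show ?thesis by auto
  next
    case False
    have "\<not> graph_iso (induced ?K S) H" if S: "S \<subseteq> {..<n}" for S
    proof
      assume "graph_iso (induced ?K S) H"
      then obtain f where f: "bij_betw f S (verts H)"
        and *: "\<And>u v. u \<in> S \<Longrightarrow> v \<in> S \<Longrightarrow> {u, v} \<in> edges (induced ?K S) \<longleftrightarrow> {f u, f v} \<in> edges H"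
        by (auto simp: graph_iso_def induced_def)
      obtain u v where uv: "u \<in> S" "v \<in> S" "f u = a" "f v = b" using pre[OF f] by auto
      then have "u \<noteq> v" using ab by auto
      then have "{u, v} \<in> edges (induced ?K S)" using uv S by (auto simp: induced_def)
      then show False using * uv False by auto
    qed
    then have "?K \<in> Forb n H" using sK by (auto simp: Forb_def)
    then show ?thesis by auto
  qed
qed

lemma graph_dist_Forb_le:
  assumes "simple_graph G" "card (verts G) = n" "H' \<in> Forb n H"
  shows "graph_dist G H' \<le> n choose 2"
proof -
  have "simple_graph H'" "card (verts G) = card (verts H')" using assms by (simp_all add: Forb_def)
  from graph_dist_le[OF assms(1) this] show ?thesis using assms(2) by simp
qed

lemma family_dist_finite:
  fixes H :: "'a sgraph"
  assumes "simple_graph G" "card (verts G) = n"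
  shows "finite {graph_dist G H' | H'. H' \<in> Forb n H}"
  by (rule finite_subset[of _ "{..n choose 2}"])
    (use graph_dist_Forb_le[OF assms] in auto)

lemma max_dist_finite:
  fixes H :: "'a sgraph"
  assumes "simple_graph H" "card (verts H) \<ge> 2"
  shows "finite {family_dist G (Forb n H) | G :: nat sgraph. simple_graph G \<and> card (verts G) = n}"
proof (rule finite_subset[of _ "{..n choose 2}"])
  have "family_dist G (Forb n H) \<le> n choose 2"
    if G: "simple_graph G" "card (verts G) = n" for G :: "nat sgraph"
  proof -
    have "family_dist G (Forb n H) \<in> {graph_dist G H' | H'. H' \<in> Forb n H}"
      unfolding family_dist_def
      by (rule Min_in[OF family_dist_finite[OF G]]) (use Forb_nonempty[OF assms] in auto)
    then show ?thesis using graph_dist_Forb_le[OF G] by auto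
  qed
  then show "{family_dist G (Forb n H) | G :: nat sgraph. simple_graph G \<and> card (verts G) = n}
      \<subseteq> {..n choose 2}" by auto
qed simp

lemma max_dist_nonempty:
  "{family_dist G \<H> | G :: nat sgraph. simple_graph G \<and> card (verts G) = n} \<noteq> {}"
proof -
  have "simple_graph \<lparr>verts = {..<n}, edges = {}\<rparr>" "card (verts \<lparr>verts = {..<n}, edges = {}\<rparr>) = n"
    by (simp_all add: simple_graph_def)
  then show ?thesis by blast
qed

end

theory Submission
  imports Defs "HOL-Library.FuncSet" "HOL-Library.Ramsey" "HOL-Analysis.Convex"
begin

text \<open>
  Let \<open>G\<close> be a quasirandom graph of density \<open>1/2\<close>, namely a graph on sets \<open>A, B\<close> with adjacency given by
  the parity of \<open>card (A \<inter> B)\<close>, and suppose that an \<open>H\<close>-free graph \<open>G'\<close> arises from \<open>G\<close> by at most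
  \<open>(1 - \<epsilon>) n\<^sup>2 / (4 k)\<close> edits. By weak (Frieze-Kannan) regularity the adjacency of \<open>G'\<close> is close in cut
  norm to a block function \<open>W\<close>, so \<open>W\<close> has small induced \<open>H\<close>-density. As \<open>G\<close> has density
  about \<open>1/2\<close> on every block, the \<open>L\<^sup>1\<close> distance of \<open>W\<close> from \<open>1/2\<close> is bounded by the number of edits,
  whence the gray pairs, those with \<open>\<eta> \<le> W \<le> 1 - \<eta>\<close>, have density more than \<open>1 - 1/k\<close>. In a
  constant size random sample Erdos-Stone then finds \<open>k + 1\<close> large classes with all cross pairs gray.
  Ramsey's theorem makes each class uniformly \<open>W \<ge> 1/2\<close> or uniformly \<open>W < 1/2\<close>, and a partition of \<open>H\<close>
  with the corresponding number of cliques embeds \<open>H\<close> with weight bounded below. The sample size does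
  not depend on the number of blocks, so the induced \<open>H\<close>-density of \<open>W\<close> is bounded away from zero, a contradiction.
\<close>

section \<open>Weak regularity\<close>

text \<open>The cut norm controls only sums over large sets, so \<open>H\<close> cannot be placed
  locally in a few regular cells. Total weights have to be compared, and this needs a lower bound
  for the weight of \<open>H\<close> in \<open>W\<close> that is known before the error is chosen.
  Hence the order of the constants: the gray threshold \<eta>, the density bound \<open>c0\<close>,
  the regularity error \<delta> below \<open>c0\<close>, the round bound \<open>J\<close>, and last
  the discrepancy \<gamma> of the quasirandom graph, which is paid once per pair of cells.

  The value 4k: a pair that is not gray lies at distance almost 1/2 from 1/2, so a density 1/k of
  such ordered pairs costs about n^2/(2k) changed ordered pairs, and each edit changes two of them.

  A gray pair admits an edge and a non-edge alike, so between classes the adjacency in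
  \<open>H\<close> is irrelevant. Inside a class only one of the two is guaranteed, and Ramsey's
  theorem gives no control over which. The number of clique classes is therefore arbitrary, and
  \<open>H\<close> must have a partition for every such number; this is what the binary chromatic
  number provides.\<close>

definition block_mean :: "'z set \<Rightarrow> ('z \<Rightarrow> 'l) \<Rightarrow> ('z \<Rightarrow> real) \<Rightarrow> 'l \<Rightarrow> real" where
  "block_mean Z C f l = (\<Sum>z\<in>{z\<in>Z. C z = l}. f z) / real (card {z\<in>Z. C z = l})"

text \<open>Block averaging is the conditional expectation given the label \<open>C z\<close>, that
  is, the orthogonal projection onto functions of the label; on each fibre \<psi> is constant and
  comes out of the sum.\<close>

lemma block_mean_adjoint:
  assumes "finite Z"
  shows "(\<Sum>z\<in>Z. block_mean Z C f (C z) * \<psi> (C z)) = (\<Sum>z\<in>Z. f z * \<psi> (C z))"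
proof -
  have "(\<Sum>z\<in>{z\<in>Z. C z = l}. block_mean Z C f (C z) * \<psi> (C z)) = (\<Sum>z\<in>{z\<in>Z. C z = l}. f z * \<psi> (C z))"
    if l: "l \<in> C ` Z" for l
  proof -
    have ne: "card {z\<in>Z. C z = l} \<noteq> 0" using l assms by auto
    have "(\<Sum>z\<in>{z\<in>Z. C z = l}. block_mean Z C f (C z) * \<psi> (C z)) = (\<Sum>z\<in>{z\<in>Z. C z = l}. block_mean Z C f l * \<psi> l)"
      by (rule sum.cong) auto
    also have "\<dots> = (\<Sum>z\<in>{z\<in>Z. C z = l}. f z) * \<psi> l"
      using ne by (simp add: block_mean_def)
    also have "\<dots> = (\<Sum>z\<in>{z\<in>Z. C z = l}. f z * \<psi> (C z))"
      unfolding sum_distrib_right by (rule sum.cong) auto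
    finally show ?thesis .
  qed
  then show ?thesis
    by (subst (1 2) sum.image_gen[OF assms, of _ C]) (rule sum.cong, auto)
qed

text \<open>The averaged function is constant on each fibre, so there the absolute value may be
  taken after summation. An L1 distance thus becomes a sum of block discrepancies.\<close>

lemma sum_abs_block_mean_diff:
  assumes "finite Z"
  shows "(\<Sum>z\<in>Z. \<bar>block_mean Z C f (C z) - a\<bar>) = (\<Sum>l\<in>C ` Z. \<bar>\<Sum>z\<in>{z\<in>Z. C z = l}. (f z - a)\<bar>)"
proof -
  have "(\<Sum>z\<in>{z\<in>Z. C z = l}. \<bar>block_mean Z C f (C z) - a\<bar>) = \<bar>\<Sum>z\<in>{z\<in>Z. C z = l}. (f z - a)\<bar>"
    if l: "l \<in> C ` Z" for l
  proof -
    have ne: "real (card {z\<in>Z. C z = l}) > 0" using l assms card_gt_0_iff by fastforce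
    have "(\<Sum>z\<in>{z\<in>Z. C z = l}. \<bar>block_mean Z C f (C z) - a\<bar>) = (\<Sum>z\<in>{z\<in>Z. C z = l}. \<bar>block_mean Z C f l - a\<bar>)"
      by (rule sum.cong) auto
    also have "\<dots> = \<bar>real (card {z\<in>Z. C z = l}) * (block_mean Z C f l - a)\<bar>"
      using ne by (simp add: abs_mult)
    also have "real (card {z\<in>Z. C z = l}) * (block_mean Z C f l - a) = (\<Sum>z\<in>{z\<in>Z. C z = l}. (f z - a))"
      using ne by (simp add: block_mean_def sum_subtractf field_simps)
    finally show ?thesis .
  qed
  then show ?thesis
    by (subst sum.image_gen[OF assms, of _ C]) (rule sum.cong, auto)
qed

lemma block_mean_bounds:
  assumes "\<And>z. z \<in> Z \<Longrightarrow> 0 \<le> f z \<and> f z \<le> 1"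
  shows "0 \<le> block_mean Z C f l" "block_mean Z C f l \<le> 1"
proof -
  show "0 \<le> block_mean Z C f l"
    unfolding block_mean_def using assms by (intro divide_nonneg_nonneg sum_nonneg) auto
  have "(\<Sum>z\<in>{z\<in>Z. C z = l}. f z) \<le> real (card {z\<in>Z. C z = l}) * 1"
    by (rule sum_bounded_above) (use assms in auto)
  then show "block_mean Z C f l \<le> 1"
    unfolding block_mean_def by (cases "card {z\<in>Z. C z = l} = 0") (auto simp: divide_simps)
qed

text \<open>Pythagoras: the coarse mean is the projection of the fine one, because the coarse label
  is a function \<open>r\<close> of the fine label.\<close>

lemma block_mean_refine:
  assumes "finite Z" and r: "\<And>z. z \<in> Z \<Longrightarrow> C z = r (C' z)"
  shows "(\<Sum>z\<in>Z. (block_mean Z C' f (C' z))\<^sup>2) - (\<Sum>z\<in>Z. (block_mean Z C f (C z))\<^sup>2)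
    = (\<Sum>z\<in>Z. (block_mean Z C' f (C' z) - block_mean Z C f (C z))\<^sup>2)"
proof -
  let ?w = "\<lambda>z. block_mean Z C f (C z)" and ?w' = "\<lambda>z. block_mean Z C' f (C' z)"
  have "(\<Sum>z\<in>Z. ?w' z * ?w z) = (\<Sum>z\<in>Z. ?w' z * block_mean Z C f (r (C' z)))"
    by (rule sum.cong) (use r in auto)
  also have "\<dots> = (\<Sum>z\<in>Z. f z * block_mean Z C f (r (C' z)))"
    by (rule block_mean_adjoint[OF assms(1)])
  also have "\<dots> = (\<Sum>z\<in>Z. f z * ?w z)"
    by (rule sum.cong) (use r in auto)
  also have "\<dots> = (\<Sum>z\<in>Z. (?w z)\<^sup>2)"
    unfolding block_mean_adjoint[OF assms(1), symmetric] power2_eq_square ..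
  finally have "(\<Sum>z\<in>Z. ?w' z * ?w z) = (\<Sum>z\<in>Z. (?w z)\<^sup>2)" .
  then show ?thesis
    by (simp add: power2_diff sum.distrib sum_subtractf mult.assoc flip: sum_distrib_left)
qed

lemma block_mean_swap:
  assumes "\<And>x y. f (x, y) = f (y, x)"
  shows "block_mean (V \<times> V) (map_prod c c) f (a, b) = block_mean (V \<times> V) (map_prod c c) f (b, a)"
proof -
  have bij: "bij_betw prod.swap {z \<in> V \<times> V. map_prod c c z = (a, b)} {z \<in> V \<times> V. map_prod c c z = (b, a)}"
    by (rule bij_betwI[where g = prod.swap]) auto
  have "f (prod.swap z) = f z" for z using assms by (cases z) auto
  then show ?thesis
    unfolding block_mean_def
    using sum.reindex_bij_betw[OF bij, of f] bij_betw_same_card[OF bij] by simp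
qed

text \<open>Energy increment: a pair \<open>S\<close>, \<open>T\<close> violating the bound is used
  to split every cell by membership in \<open>S\<close> and in \<open>T\<close>, which raises the
  mean square of the block function by at least \<delta>^2. That mean square never exceeds 1, so the
  hypothesis on \<open>J\<close> forces a stop within \<open>J\<close> rounds. Labels record the
  history, two bits a round, whence at most 4^j cells.\<close>

lemma weak_regularity:
  fixes f :: "'v \<times> 'v \<Rightarrow> real"
  assumes V: "finite V" "V \<noteq> {}"
    and f: "\<And>z. z \<in> V \<times> V \<Longrightarrow> 0 \<le> f z \<and> f z \<le> 1"
    and \<delta>: "\<delta> > 0" and J: "real J * \<delta>\<^sup>2 > 1"
  shows "\<exists>c :: 'v \<Rightarrow> bool list. \<exists>j\<le>J. (\<forall>x. length (c x) = 2 * j) \<and>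
    (\<forall>S\<subseteq>V. \<forall>T\<subseteq>V. \<bar>\<Sum>z\<in>S \<times> T. f z - block_mean (V \<times> V) (map_prod c c) f (map_prod c c z)\<bar>
      \<le> \<delta> * (real (card V))\<^sup>2)"
proof -
  define n where "n = real (card V)"
  have n: "n > 0" using V by (auto simp: n_def card_gt_0_iff)
  define Z where "Z = V \<times> V"
  have finZ: "finite Z" and cZ: "real (card Z) = n\<^sup>2" using V by (auto simp: Z_def n_def power2_eq_square)
  define W where "W = (\<lambda>c :: 'v \<Rightarrow> bool list. \<lambda>z. block_mean Z (map_prod c c) f (map_prod c c z))"
  define energy where "energy = (\<lambda>c. \<Sum>z\<in>Z. (W c z)\<^sup>2)"
  define reg where "reg = (\<lambda>c. \<forall>S\<subseteq>V. \<forall>T\<subseteq>V. \<bar>\<Sum>z\<in>S \<times> T. f z - W c z\<bar> \<le> \<delta> * n\<^sup>2)"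
  have energy_le: "energy c \<le> n\<^sup>2" for c
  proof -
    have "0 \<le> W c z \<and> W c z \<le> 1" for z
      unfolding W_def using block_mean_bounds[of Z f] f Z_def by auto
    then have "(\<Sum>z\<in>Z. (W c z)\<^sup>2) \<le> (\<Sum>z\<in>Z. 1)"
      by (intro sum_mono) (simp add: power_le_one)
    then show ?thesis using cZ by (simp add: energy_def)
  qed
  have step: "\<exists>c'. (\<forall>x. length (c' x) = length (c x) + 2) \<and> energy c' \<ge> energy c + \<delta>\<^sup>2 * n\<^sup>2"
    if nr: "\<not> reg c" for c
  proof -
    obtain S T where ST: "S \<subseteq> V" "T \<subseteq> V" and big: "\<bar>\<Sum>z\<in>S \<times> T. f z - W c z\<bar> > \<delta> * n\<^sup>2"
      using nr by (auto simp: reg_def not_le)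
    define c' where "c' = (\<lambda>x. (x \<in> S) # (x \<in> T) # c x)"
    define r :: "bool list \<times> bool list \<Rightarrow> bool list \<times> bool list" where "r = map_prod (drop 2) (drop 2)"
    have r: "map_prod c c z = r (map_prod c' c' z)" for z
      by (cases z) (auto simp: r_def c'_def)
    let ?d = "\<lambda>z. W c' z - W c z"
    have sub: "S \<times> T \<subseteq> Z" using ST by (auto simp: Z_def)
    \<comment> \<open>The indicator of \<open>S \<times> T\<close> can be read off the two new bits,
      so it is a function of the fine label and averaging over the refined cells preserves sums over
      \<open>S \<times> T\<close>.\<close>
    define \<psi> where "\<psi> = (\<lambda>(k :: bool list, l :: bool list). if hd k \<and> hd (tl l) then 1 else (0::real))"
    have \<psi>: "\<psi> (map_prod c' c' z) = (if z \<in> S \<times> T then 1 else 0)" for z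
      by (cases z) (auto simp: \<psi>_def c'_def)
    have ind: "(\<Sum>z\<in>Z. u z * \<psi> (map_prod c' c' z)) = (\<Sum>z\<in>S \<times> T. u z)" for u
    proof -
      have "(\<Sum>z\<in>Z. u z * \<psi> (map_prod c' c' z)) = (\<Sum>z\<in>Z. if z \<in> S \<times> T then u z else 0)"
        unfolding \<psi> by (rule sum.cong) auto
      then show ?thesis using sub by (simp add: sum.inter_restrict[OF finZ, symmetric] inf.absorb2)
    qed
    have "(\<Sum>z\<in>S \<times> T. W c' z) = (\<Sum>z\<in>S \<times> T. f z)"
      using block_mean_adjoint[OF finZ, of "map_prod c' c'" f \<psi>] by (simp add: ind W_def)
    then have "\<bar>\<Sum>z\<in>S \<times> T. ?d z\<bar> > \<delta> * n\<^sup>2" using big by (simp add: sum_subtractf)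
    then have "(\<delta> * n\<^sup>2)\<^sup>2 \<le> (\<Sum>z\<in>S \<times> T. ?d z)\<^sup>2"
      using \<delta> by (metis abs_le_square_iff abs_of_nonneg less_imp_le mult_nonneg_nonneg zero_le_power2)
    \<comment> \<open>Cauchy-Schwarz turns the discrepancy on \<open>S \<times> T\<close> into a
      lower bound for the squared distance of the two block functions, which is the energy
      gain.\<close>
    also have "\<dots> \<le> real (card (S \<times> T)) * (\<Sum>z\<in>S \<times> T. (?d z)\<^sup>2)"
      using sum_squared_le_sum_of_squares[of ?d "S \<times> T"] finite_subset[OF sub finZ] by (simp add: mult.commute)
    also have "\<dots> \<le> n\<^sup>2 * (\<Sum>z\<in>Z. (?d z)\<^sup>2)"
    proof (rule mult_mono)
      show "real (card (S \<times> T)) \<le> n\<^sup>2" using card_mono[OF finZ sub] cZ by linarith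
      show "(\<Sum>z\<in>S \<times> T. (?d z)\<^sup>2) \<le> (\<Sum>z\<in>Z. (?d z)\<^sup>2)" by (rule sum_mono2[OF finZ sub]) auto
    qed (auto intro: sum_nonneg)
    also have "(\<Sum>z\<in>Z. (?d z)\<^sup>2) = energy c' - energy c"
      unfolding energy_def W_def by (rule block_mean_refine[OF finZ, symmetric]) (rule r)
    finally have "n\<^sup>2 * (\<delta>\<^sup>2 * n\<^sup>2) \<le> n\<^sup>2 * (energy c' - energy c)"
      by (simp add: power_mult_distrib power2_eq_square mult_ac)
    then have "\<delta>\<^sup>2 * n\<^sup>2 \<le> energy c' - energy c" using n by simp
    then show ?thesis by (intro exI[of _ c']) (auto simp: c'_def)
  qed
  have iter: "(\<exists>c. \<exists>i\<le>j. (\<forall>x. length (c x) = 2 * i) \<and> reg c) \<or>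
      (\<exists>c. (\<forall>x. length (c x) = 2 * j) \<and> energy c \<ge> real j * (\<delta>\<^sup>2 * n\<^sup>2))" for j
  proof (induction j)
    case 0
    have "energy (\<lambda>_. []) \<ge> 0" by (auto simp: energy_def intro: sum_nonneg)
    then show ?case by (intro disjI2 exI[of _ "\<lambda>_. []"]) auto
  next
    case (Suc j)
    show ?case
    proof (cases "\<exists>c. \<exists>i\<le>Suc j. (\<forall>x. length (c x) = 2 * i) \<and> reg c")
      case False
      then obtain c where c: "\<forall>x. length (c x) = 2 * j" "energy c \<ge> real j * (\<delta>\<^sup>2 * n\<^sup>2)"
        using Suc le_SucI by metis
      have "\<not> reg c" using False c(1) by (meson le_SucI order_refl)
      from step[OF this] obtain c' where c': "\<forall>x. length (c' x) = length (c x) + 2" "energy c' \<ge> energy c + \<delta>\<^sup>2 * n\<^sup>2"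
        by auto
      then show ?thesis using c by (intro disjI2 exI[of _ c']) (auto simp: algebra_simps)
    qed auto
  qed
  have "\<not> energy c \<ge> real J * (\<delta>\<^sup>2 * n\<^sup>2)" for c
  proof -
    have "n\<^sup>2 * 1 < n\<^sup>2 * (real J * \<delta>\<^sup>2)" using J n by (intro mult_strict_left_mono) auto
    then show ?thesis using energy_le[of c] by (simp add: mult_ac)
  qed
  then obtain c i where "i \<le> J" "\<forall>x. length (c x) = 2 * i" "reg c" using iter[of J] by blast
  then show ?thesis unfolding reg_def W_def Z_def n_def by blast
qed

text \<open>For fixed \<open>q\<close> the form is linear in \<open>p\<close>, so it is largest when
  \<open>p\<close> is the indicator of the rows with positive sum; then the same is done for
  \<open>q\<close>. Weights in [0,1] thus give no more than sets do.\<close>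

lemma cut_norm_functions:
  fixes D :: "'v \<Rightarrow> 'v \<Rightarrow> real"
  assumes V: "finite V"
    and cut: "\<And>S T. S \<subseteq> V \<Longrightarrow> T \<subseteq> V \<Longrightarrow> \<bar>\<Sum>x\<in>S. \<Sum>y\<in>T. D x y\<bar> \<le> B"
    and p: "\<And>x. x \<in> V \<Longrightarrow> 0 \<le> p x \<and> p x \<le> 1" and q: "\<And>x. x \<in> V \<Longrightarrow> 0 \<le> q x \<and> q x \<le> 1"
  shows "\<bar>\<Sum>x\<in>V. \<Sum>y\<in>V. p x * q y * D x y\<bar> \<le> B"
proof -
  have pos: "(\<Sum>x\<in>V. u x * r x) \<le> (\<Sum>x\<in>{x\<in>V. r x > 0}. r x)"
    if u: "\<And>x. x \<in> V \<Longrightarrow> 0 \<le> u x \<and> u x \<le> 1" for u r :: "'v \<Rightarrow> real"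
  proof -
    have "(\<Sum>x\<in>V. u x * r x) \<le> (\<Sum>x\<in>V. if r x > 0 then r x else 0)"
    proof (rule sum_mono)
      fix x assume "x \<in> V"
      then show "u x * r x \<le> (if r x > 0 then r x else 0)"
        using u[of x] by (auto simp: mult_left_le_one_le mult_nonneg_nonpos)
    qed
    also have "\<dots> = (\<Sum>x\<in>{x\<in>V. r x > 0}. r x)" by (rule sum.inter_filter[OF V, symmetric])
    finally show ?thesis .
  qed
  have upper: "(\<Sum>x\<in>V. \<Sum>y\<in>V. p x * q y * E x y) \<le> B"
    if E: "\<And>S T. S \<subseteq> V \<Longrightarrow> T \<subseteq> V \<Longrightarrow> \<bar>\<Sum>x\<in>S. \<Sum>y\<in>T. E x y\<bar> \<le> B" for E
  proof -
    define S where "S = {x\<in>V. (\<Sum>y\<in>V. q y * E x y) > 0}"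
    define T where "T = {y\<in>V. (\<Sum>x\<in>S. E x y) > 0}"
    have "(\<Sum>x\<in>V. \<Sum>y\<in>V. p x * q y * E x y) = (\<Sum>x\<in>V. p x * (\<Sum>y\<in>V. q y * E x y))"
      by (simp add: sum_distrib_left mult.assoc)
    also have "\<dots> \<le> (\<Sum>x\<in>S. \<Sum>y\<in>V. q y * E x y)" unfolding S_def by (rule pos[OF p])
    also have "\<dots> = (\<Sum>y\<in>V. q y * (\<Sum>x\<in>S. E x y))"
      by (subst sum.swap) (simp add: sum_distrib_left)
    also have "\<dots> \<le> (\<Sum>y\<in>T. \<Sum>x\<in>S. E x y)" unfolding T_def by (rule pos[OF q])
    also have "\<dots> = (\<Sum>x\<in>S. \<Sum>y\<in>T. E x y)" by (rule sum.swap)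
    also have "\<dots> \<le> B" using E[of S T] by (auto simp: S_def T_def)
    finally show ?thesis .
  qed
  have "(\<Sum>x\<in>V. \<Sum>y\<in>V. p x * q y * - D x y) \<le> B"
    by (rule upper) (use cut in \<open>simp add: sum_negf\<close>)
  then show ?thesis using upper[of D] cut by (simp add: sum_negf)
qed

section \<open>Counting lemma\<close>

lemma sum_PiE_split_two:
  fixes F :: "('i \<Rightarrow> 'v) \<Rightarrow> real"
  assumes "a \<in> J" "b \<in> J" "a \<noteq> b"
  shows "(\<Sum>z\<in>J \<rightarrow>\<^sub>E V. F z) = (\<Sum>z\<in>(J - {a, b}) \<rightarrow>\<^sub>E V. \<Sum>x\<in>V. \<Sum>y\<in>V. F (z(b := y, a := x)))"
proof -
  have ins: "(\<Sum>z\<in>insert i I \<rightarrow>\<^sub>E V. G z) = (\<Sum>z\<in>I \<rightarrow>\<^sub>E V. \<Sum>x\<in>V. G (z(i := x)))"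
    if "i \<notin> I" for i I and G :: "('i \<Rightarrow> 'v) \<Rightarrow> real"
  proof -
    have "(\<Sum>z\<in>insert i I \<rightarrow>\<^sub>E V. G z) = (\<Sum>(x, z)\<in>V \<times> (I \<rightarrow>\<^sub>E V). G (z(i := x)))"
      unfolding PiE_insert_eq
      by (subst sum.reindex[OF inj_combinator[OF that]]) (rule sum.cong, auto)
    also have "\<dots> = (\<Sum>x\<in>V. \<Sum>z\<in>I \<rightarrow>\<^sub>E V. G (z(i := x)))"
      by (rule sum.cartesian_product[symmetric])
    also have "\<dots> = (\<Sum>z\<in>I \<rightarrow>\<^sub>E V. \<Sum>x\<in>V. G (z(i := x)))" by (rule sum.swap)
    finally show ?thesis .
  qed
  have "J = insert a (insert b (J - {a, b}))" using assms by auto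
  then have "(\<Sum>z\<in>J \<rightarrow>\<^sub>E V. F z) = (\<Sum>z\<in>insert a (insert b (J - {a, b})) \<rightarrow>\<^sub>E V. F z)" by simp
  also have "\<dots> = (\<Sum>z\<in>insert b (J - {a, b}) \<rightarrow>\<^sub>E V. \<Sum>x\<in>V. F (z(a := x)))"
    by (rule ins) (use assms in auto)
  also have "\<dots> = (\<Sum>z\<in>(J - {a, b}) \<rightarrow>\<^sub>E V. \<Sum>y\<in>V. \<Sum>x\<in>V. F (z(b := y, a := x)))"
    by (rule ins) auto
  also have "\<dots> = (\<Sum>z\<in>(J - {a, b}) \<rightarrow>\<^sub>E V. \<Sum>x\<in>V. \<Sum>y\<in>V. F (z(b := y, a := x)))"
    by (rule sum.cong[OF refl], rule sum.swap)
  finally show ?thesis .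
qed

text \<open>Freeze all coordinates except \<open>a\<close> and \<open>b\<close>. As (a, b) is not in
  \<open>Q\<close>, no factor depends on both, so the product splits into a function of
  \<open>z a\<close> times a function of \<open>z b\<close>, and the cut norm bounds the inner
  double sum.\<close>

lemma cut_norm_single_pair:
  fixes D :: "'v \<Rightarrow> 'v \<Rightarrow> real" and g :: "nat \<times> nat \<Rightarrow> 'v \<Rightarrow> 'v \<Rightarrow> real"
  assumes J: "finite J" and V: "finite V" and ab: "a \<in> J" "b \<in> J" "a < b"
    and cut: "\<And>S T. S \<subseteq> V \<Longrightarrow> T \<subseteq> V \<Longrightarrow> \<bar>\<Sum>x\<in>S. \<Sum>y\<in>T. D x y\<bar> \<le> \<delta> * (real (card V))\<^sup>2"
    and Q: "finite Q" "Q \<subseteq> {(u, v). u \<in> J \<and> v \<in> J \<and> u < v}" "(a, b) \<notin> Q"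
    and g: "\<And>e x y. x \<in> V \<Longrightarrow> y \<in> V \<Longrightarrow> 0 \<le> g e x y \<and> g e x y \<le> 1"
  shows "\<bar>\<Sum>z\<in>J \<rightarrow>\<^sub>E V. (\<Prod>(u, v)\<in>Q. g (u, v) (z u) (z v)) * D (z a) (z b)\<bar> \<le> \<delta> * real (card V) ^ card J"
proof -
  define n where "n = real (card V)"
  define Qa where "Qa = {e \<in> Q. fst e = a \<or> snd e = a}"
  define Qb where "Qb = Q - Qa"
  let ?g = "\<lambda>z. \<lambda>(u, v). g (u, v) (z u) (z v)"
  have Qsub: "Qa \<subseteq> Q" "Qb \<subseteq> Q" by (auto simp: Qa_def Qb_def)
  have QQ: "Q = Qa \<union> Qb" "Qa \<inter> Qb = {}" "finite Qa" "finite Qb" using Q by (auto simp: Qa_def Qb_def)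
  have one: "\<bar>\<Sum>x\<in>V. \<Sum>y\<in>V. prod (?g (z(b := y, a := x))) Q * D x y\<bar> \<le> \<delta> * n\<^sup>2"
    if z: "z \<in> (J - {a, b}) \<rightarrow>\<^sub>E V" for z
  proof (cases "V = {}")
    case True
    then show ?thesis by (simp add: n_def)
  next
    case False
    \<comment> \<open>\<open>v0\<close> is a dummy value: the factors in \<open>Qa\<close> do not
      involve coordinate \<open>b\<close>, and those in \<open>Qb\<close> do not involve
      \<open>a\<close>.\<close>
    then obtain v0 where v0: "v0 \<in> V" by auto
    define p where "p = (\<lambda>x. prod (?g (z(b := v0, a := x))) Qa)"
    define q where "q = (\<lambda>y. prod (?g (z(b := y, a := v0))) Qb)"
    have bounds: "0 \<le> prod (?g (z(b := y, a := x))) Q' \<and> prod (?g (z(b := y, a := x))) Q' \<le> 1"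
      if "x \<in> V" "y \<in> V" "Q' \<subseteq> Q" for x y Q'
    proof -
      have zV: "(z(b := y, a := x)) u \<in> V" if "u \<in> J" for u
      proof (cases "u = a \<or> u = b")
        case False
        then have "u \<in> J - {a, b}" using that by simp
        then show ?thesis using PiE_mem[OF z] False by simp
      qed (use \<open>x \<in> V\<close> \<open>y \<in> V\<close> in auto)
      have "0 \<le> ?g (z(b := y, a := x)) e \<and> ?g (z(b := y, a := x)) e \<le> 1" if "e \<in> Q'" for e
      proof -
        obtain u v where uv: "e = (u, v)" by (cases e)
        then have "u \<in> J" "v \<in> J" using that \<open>Q' \<subseteq> Q\<close> Q(2) by auto
        from g[OF zV[OF this(1)] zV[OF this(2)], of e] show ?thesis unfolding uv by simp
      qed
      then show ?thesis using prod_nonneg[of Q' "?g (z(b := y, a := x))"] prod_le_1[of Q' "?g (z(b := y, a := x))"] by blast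
    qed
    have "prod (?g (z(b := y, a := x))) Q = p x * q y" for x y
    proof -
      have "prod (?g (z(b := y, a := x))) Q = prod (?g (z(b := y, a := x))) Qa * prod (?g (z(b := y, a := x))) Qb"
        unfolding QQ(1) by (rule prod.union_disjoint[OF QQ(3,4,2)])
      also have "prod (?g (z(b := y, a := x))) Qa = p x"
        unfolding p_def by (rule prod.cong) (use Q ab in \<open>auto simp: Qa_def\<close>)
      also have "prod (?g (z(b := y, a := x))) Qb = q y"
        unfolding q_def by (rule prod.cong) (auto simp: Qb_def Qa_def)
      finally show ?thesis .
    qed
    then have "(\<Sum>x\<in>V. \<Sum>y\<in>V. prod (?g (z(b := y, a := x))) Q * D x y) = (\<Sum>x\<in>V. \<Sum>y\<in>V. p x * q y * D x y)"
      by simp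
    moreover have "\<bar>\<dots>\<bar> \<le> \<delta> * n\<^sup>2"
      by (rule cut_norm_functions[OF V])
        (use cut bounds[OF _ v0, of _ Qa] bounds[OF v0, of _ Qb] Qsub in \<open>simp_all add: n_def p_def q_def\<close>)
    ultimately show ?thesis by simp
  qed
  have "(\<Sum>z\<in>J \<rightarrow>\<^sub>E V. prod (?g z) Q * D (z a) (z b))
      = (\<Sum>z\<in>(J - {a, b}) \<rightarrow>\<^sub>E V. \<Sum>x\<in>V. \<Sum>y\<in>V. prod (?g (z(b := y, a := x))) Q * D x y)"
    by (subst sum_PiE_split_two[of a J b]) (use ab in auto)
  also have "\<bar>\<dots>\<bar> \<le> (\<Sum>z\<in>(J - {a, b}) \<rightarrow>\<^sub>E V. \<delta> * n\<^sup>2)"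
    by (rule order_trans[OF sum_abs], rule sum_mono, rule one)
  also have "\<dots> = \<delta> * n ^ card J"
  proof -
    have "card {a, b} \<le> card J" by (rule card_mono[OF J]) (use ab in auto)
    then have "card J = card (J - {a, b}) + 2" using ab J by (simp add: card_Diff_subset)
    then show ?thesis using J by (simp add: card_funcsetE n_def power_add power2_eq_square)
  qed
  finally show ?thesis by (simp add: n_def)
qed

text \<open>Telescoping: the factors \<open>f\<close> are exchanged for \<open>f'\<close> one pair
  at a time, and each exchange costs one application of \<open>cut_norm_single_pair\<close>.\<close>

lemma counting_lemma:
  fixes f f' :: "nat \<times> nat \<Rightarrow> 'v \<Rightarrow> 'v \<Rightarrow> real"
  assumes J: "finite J" and V: "finite V"
    and S: "S \<subseteq> {(u, v). u \<in> J \<and> v \<in> J \<and> u < v}"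
    and cut: "\<And>e A B. A \<subseteq> V \<Longrightarrow> B \<subseteq> V \<Longrightarrow> \<bar>\<Sum>x\<in>A. \<Sum>y\<in>B. f e x y - f' e x y\<bar> \<le> \<delta> * (real (card V))\<^sup>2"
    and f: "\<And>e x y. x \<in> V \<Longrightarrow> y \<in> V \<Longrightarrow> 0 \<le> f e x y \<and> f e x y \<le> 1"
    and f': "\<And>e x y. x \<in> V \<Longrightarrow> y \<in> V \<Longrightarrow> 0 \<le> f' e x y \<and> f' e x y \<le> 1"
  shows "\<bar>(\<Sum>z\<in>J \<rightarrow>\<^sub>E V. \<Prod>(u, v)\<in>S. f (u, v) (z u) (z v)) - (\<Sum>z\<in>J \<rightarrow>\<^sub>E V. \<Prod>(u, v)\<in>S. f' (u, v) (z u) (z v))\<bar>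
    \<le> real (card S) * \<delta> * real (card V) ^ card J"
proof -
  let ?P = "{(u, v). u \<in> J \<and> v \<in> J \<and> u < v}"
  let ?B = "\<delta> * real (card V) ^ card J"
  have finP: "finite ?P" by (rule finite_subset[of _ "J \<times> J"]) (use J in auto)
  \<comment> \<open>The induction carries an extra product of weights \<open>g\<close> over a
    disjoint set \<open>T\<close>, which collects the factors not being exchanged at the
    moment.\<close>
  have "\<bar>\<Sum>z\<in>J \<rightarrow>\<^sub>E V. (\<Prod>(u, v)\<in>T. g (u, v) (z u) (z v)) *
        ((\<Prod>(u, v)\<in>S. f (u, v) (z u) (z v)) - (\<Prod>(u, v)\<in>S. f' (u, v) (z u) (z v)))\<bar> \<le> real (card S) * ?B"
    if "finite S" "S \<subseteq> ?P" "T \<subseteq> ?P" "S \<inter> T = {}"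
      "\<And>e x y. x \<in> V \<Longrightarrow> y \<in> V \<Longrightarrow> 0 \<le> g e x y \<and> g e x y \<le> 1" for S T and g :: "nat \<times> nat \<Rightarrow> 'v \<Rightarrow> 'v \<Rightarrow> real"
    using that
  proof (induction S arbitrary: T g rule: finite_induct)
    case empty
    then show ?case by simp
  next
    case (insert e S)
    obtain a b where e: "e = (a, b)" by (cases e)
    have ab: "a \<in> J" "b \<in> J" "a < b" using insert.prems e by auto
    have finT: "finite T" using finP insert.prems(2) finite_subset by blast
    have eT: "(a, b) \<notin> T" and eS: "(a, b) \<notin> S" using insert e by auto
    \<comment> \<open>\<open>g1\<close> moves the factor \<open>f e\<close> into the collected
      product, for the exchanges still to come in \<open>S\<close>; \<open>g2\<close> holds
      \<open>f'\<close> on \<open>S\<close> and \<open>g\<close> on \<open>T\<close>, for the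
      exchange at \<open>e\<close> itself.\<close>
    define g1 where "g1 = g(e := f e)"
    define g2 where "g2 = (\<lambda>d. if d \<in> S then f' d else g d)"
    let ?G = "\<lambda>h z. \<lambda>(u, v). h (u, v) (z u) (z v) :: real"
    have T1: "prod (?G g1 z) (insert e T) = prod (?G g z) T * f e (z a) (z b)" for z
    proof -
      have "prod (?G g1 z) T = prod (?G g z) T"
        by (rule prod.cong) (use eT e in \<open>auto simp: g1_def\<close>)
      then show ?thesis using finT eT e by (simp add: g1_def)
    qed
    have T2: "prod (?G g2 z) (S \<union> T) = prod (?G g z) T * prod (?G f' z) S" for z
    proof -
      have "prod (?G g2 z) T = prod (?G g z) T"
        by (rule prod.cong) (use insert.prems in \<open>auto simp: g2_def\<close>)
      moreover have "prod (?G g2 z) S = prod (?G f' z) S"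
        by (rule prod.cong) (auto simp: g2_def)
      ultimately show ?thesis using finT insert.hyps insert.prems by (subst prod.union_disjoint) auto
    qed
    have "prod (?G g z) T * (prod (?G f z) (insert e S) - prod (?G f' z) (insert e S))
       = prod (?G g1 z) (insert e T) * (prod (?G f z) S - prod (?G f' z) S)
         + prod (?G g2 z) (S \<union> T) * (f e (z a) (z b) - f' e (z a) (z b))" for z
      unfolding T1 T2 using insert.hyps e by (simp add: algebra_simps)
    then have "(\<Sum>z\<in>J \<rightarrow>\<^sub>E V. prod (?G g z) T * (prod (?G f z) (insert e S) - prod (?G f' z) (insert e S)))
       = (\<Sum>z\<in>J \<rightarrow>\<^sub>E V. prod (?G g1 z) (insert e T) * (prod (?G f z) S - prod (?G f' z) S))
       + (\<Sum>z\<in>J \<rightarrow>\<^sub>E V. prod (?G g2 z) (S \<union> T) * (f e (z a) (z b) - f' e (z a) (z b)))"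
      by (simp add: sum.distrib)
    moreover have "\<bar>\<Sum>z\<in>J \<rightarrow>\<^sub>E V. prod (?G g1 z) (insert e T) * (prod (?G f z) S - prod (?G f' z) S)\<bar> \<le> real (card S) * ?B"
      by (rule insert.IH) (use insert.prems insert.hyps f in \<open>auto simp: g1_def\<close>)
    moreover have "\<bar>\<Sum>z\<in>J \<rightarrow>\<^sub>E V. prod (?G g2 z) (S \<union> T) * (f e (z a) (z b) - f' e (z a) (z b))\<bar> \<le> ?B"
      by (rule cut_norm_single_pair[OF J V ab cut])
        (use finT insert.prems insert.hyps eT eS f' in \<open>auto simp: g2_def\<close>)
    ultimately show ?case using insert.hyps by (simp add: algebra_simps)
  qed
  from this[of S "{}" "\<lambda>_ _ _. 0"] S finP show ?thesis
    by (auto simp: sum_subtractf mult.assoc dest: finite_subset)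
qed

section \<open>The Erdos-Stone theorem\<close>

text \<open>A complete multipartite pattern with \<open>m\<close> classes of size \<open>R\<close>.
  Distinct classes are disjoint as soon as \<open>E\<close> is irreflexive.\<close>

definition joined_blocks :: "('v \<Rightarrow> 'v \<Rightarrow> bool) \<Rightarrow> 'v set \<Rightarrow> nat \<Rightarrow> nat \<Rightarrow> (nat \<Rightarrow> 'v set) \<Rightarrow> bool" where
  "joined_blocks E U m R A \<longleftrightarrow> (\<forall>l<m. A l \<subseteq> U \<and> card (A l) = R) \<and>
     (\<forall>l<m. \<forall>l'<m. l \<noteq> l' \<longrightarrow> (\<forall>x\<in>A l. \<forall>y\<in>A l'. E x y))"

lemma large_min_degree_subset:
  fixes E :: "'v \<Rightarrow> 'v \<Rightarrow> bool"
  assumes U0: "finite U0" and sym: "\<And>x y. E x y \<Longrightarrow> E y x" and \<alpha>: "\<alpha> \<ge> 0"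
    and dense: "real (card {(x, y) \<in> U0 \<times> U0. E x y}) \<ge> (\<alpha> + \<epsilon>) * (real (card U0))\<^sup>2"
  shows "\<exists>U\<subseteq>U0. (real (card U))\<^sup>2 \<ge> \<epsilon> * (real (card U0))\<^sup>2 \<and>
    (\<forall>v\<in>U. real (card {y\<in>U. E v y}) \<ge> \<alpha> * (real (card U) - 1))"
proof -
  define e where "e = (\<lambda>U. real (card {(x, y) \<in> U \<times> U. E x y}))"
  define \<phi> where "\<phi> = (\<lambda>U. e U - \<alpha> * (real (card U))\<^sup>2)"
  \<comment> \<open>A maximiser of \<open>\<phi>\<close> has large minimum degree, as deleting a vertex cannot increase \<open>\<phi>\<close>.\<close>
  have "finite (\<phi> ` Pow U0)" "\<phi> ` Pow U0 \<noteq> {}" using U0 by auto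
  from Max_in[OF this] obtain U where U: "U \<subseteq> U0" "\<phi> U = Max (\<phi> ` Pow U0)" by auto
  have mx: "\<phi> U' \<le> \<phi> U" if "U' \<subseteq> U0" for U' using that U U0 by simp
  have fU: "finite U" using U U0 finite_subset by blast
  \<comment> \<open>At most \<open>(card U)\<^sup>2\<close> ordered pairs are counted, while the
    maximum of \<phi> is at least its value at \<open>U0\<close>; this forces \<open>U\<close> to be
    large.\<close>
  have "e U \<le> (real (card U))\<^sup>2"
  proof -
    have "card {(x, y) \<in> U \<times> U. E x y} \<le> card (U \<times> U)" by (rule card_mono) (use fU in auto)
    then have "real (card {(x, y) \<in> U \<times> U. E x y}) \<le> real (card U * card U)"
      unfolding card_cartesian_product by (rule of_nat_mono)
    then show ?thesis unfolding e_def power2_eq_square of_nat_mult .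
  qed
  moreover have "\<phi> U0 \<ge> \<epsilon> * (real (card U0))\<^sup>2" using dense by (simp add: \<phi>_def e_def algebra_simps)
  moreover have "\<phi> U \<le> e U" using \<alpha> by (simp add: \<phi>_def)
  ultimately have large: "(real (card U))\<^sup>2 \<ge> \<epsilon> * (real (card U0))\<^sup>2" using mx[of U0] by simp
  have "real (card {y\<in>U. E v y}) \<ge> \<alpha> * (real (card U) - 1)" if v: "v \<in> U" for v
  proof -
    let ?N = "{y\<in>U. E v y}"
    \<comment> \<open>Pairs are ordered, so deleting \<open>v\<close> loses each neighbour
      twice.\<close>
    have "card {(x, y) \<in> U \<times> U. E x y} \<le> card ({(x, y) \<in> (U - {v}) \<times> (U - {v}). E x y} \<union> ({v} \<times> ?N \<union> ?N \<times> {v}))"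
    proof (rule card_mono)
      have "{(x, y) \<in> (U - {v}) \<times> (U - {v}). E x y} \<subseteq> U \<times> U" by auto
      then have "finite {(x, y) \<in> (U - {v}) \<times> (U - {v}). E x y}" using fU finite_subset by blast
      then show "finite ({(x, y) \<in> (U - {v}) \<times> (U - {v}). E x y} \<union> ({v} \<times> ?N \<union> ?N \<times> {v}))" using fU by simp
      show "{(x, y) \<in> U \<times> U. E x y} \<subseteq> {(x, y) \<in> (U - {v}) \<times> (U - {v}). E x y} \<union> ({v} \<times> ?N \<union> ?N \<times> {v})"
        using sym by auto
    qed
    also have "\<dots> \<le> card {(x, y) \<in> (U - {v}) \<times> (U - {v}). E x y} + (card ?N + card ?N)"
      by (rule order_trans[OF card_Un_le], rule add_left_mono, rule order_trans[OF card_Un_le])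
        (simp add: card_cartesian_product)
    finally have "e U \<le> e (U - {v}) + 2 * real (card ?N)" unfolding e_def by linarith
    moreover have "\<phi> (U - {v}) \<le> \<phi> U" by (rule mx) (use U in auto)
    moreover have "real (card (U - {v})) = real (card U) - 1"
    proof -
      have "card U = Suc (card (U - {v}))" by (rule card_Suc_Diff1[OF fU v, symmetric])
      then show ?thesis by simp
    qed
    ultimately have "\<alpha> * (2 * real (card U) - 1) \<le> 2 * real (card ?N)"
      by (simp add: \<phi>_def power2_eq_square algebra_simps)
    moreover have "\<alpha> * (2 * real (card U) - 2) \<le> \<alpha> * (2 * real (card U) - 1)" using \<alpha> by (intro mult_left_mono) auto
    ultimately show ?thesis by (simp add: algebra_simps)
  qed
  then show ?thesis using U large by blast
qed

definition has_min_degree :: "('v \<Rightarrow> 'v \<Rightarrow> bool) \<Rightarrow> 'v set \<Rightarrow> real \<Rightarrow> bool" where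
  "has_min_degree E U d \<longleftrightarrow> (\<forall>v\<in>U. real (card {y\<in>U. E v y}) \<ge> d * real (card U))"

text \<open>One class is added at a time. Given \<open>j\<close> joined classes of a larger size
  \<open>T\<close> with union \<open>X\<close>, the degree condition and \<open>j \<le> k\<close>
  make the average vertex see at least (j - 1 + \<epsilon> j) T of \<open>X\<close>, whereas a
  vertex with fewer than \<open>R\<close> neighbours in some class sees at most (j - 1) T + R. So a
  positive proportion of vertices have \<open>R\<close> neighbours in every class; among them
  \<open>R\<close> share the same neighbourhood in \<open>X\<close>, and these form the new
  class.\<close>

lemma joined_blocks_of_min_degree:
  fixes k :: nat and \<epsilon> :: real
  assumes k: "k \<ge> 1" and \<epsilon>: "\<epsilon> > 0" and "m \<le> k"
  shows "\<exists>N. \<forall>U :: 'v set. \<forall>E. finite U \<longrightarrow> card U \<ge> N \<longrightarrow> symp E \<longrightarrow> irreflp E \<longrightarrow>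
     has_min_degree E U (1 - 1 / real k + \<epsilon>) \<longrightarrow> (\<exists>A. joined_blocks E U (Suc m) R A)"
  using \<open>m \<le> k\<close>
proof (induction m arbitrary: R)
  case 0
  show ?case
  proof (intro exI[of _ R] allI impI)
    fix U :: "'v set" and E
    assume "R \<le> card U"
    then obtain B where "B \<subseteq> U" "card B = R" using obtain_subset_with_card_n by metis
    then show "\<exists>A. joined_blocks E U (Suc 0) R A"
      by (intro exI[of _ "\<lambda>_. B"]) (auto simp: joined_blocks_def)
  qed
next
  case (Suc m)
  define j where "j = Suc m"
  have j: "1 \<le> j" "j \<le> k" using Suc.prems by (auto simp: j_def)
  \<comment> \<open>Large enough that \<open>R\<close> uses up at most half of the surplus
    \<epsilon> j T.\<close>
  obtain T :: nat where T: "real T > 2 * (real R + 1) / \<epsilon>" using reals_Archimedean2 by blast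
  then have \<epsilon>T: "\<epsilon> * real T > 2 * (real R + 1)" using \<epsilon> by (simp add: field_simps)
  have Tpos: "real T > 0" using \<epsilon>T \<epsilon> by (smt (verit) mult_nonneg_nonpos of_nat_0_le_iff)
  obtain N1 where N1: "\<forall>U :: 'v set. \<forall>E. finite U \<longrightarrow> card U \<ge> N1 \<longrightarrow> symp E \<longrightarrow> irreflp E \<longrightarrow>
     has_min_degree E U (1 - 1 / real k + \<epsilon>) \<longrightarrow> (\<exists>A. joined_blocks E U j T A)"
    using Suc.IH[of T] Suc.prems unfolding j_def by auto
  \<comment> \<open>Makes the \<epsilon> n / 2 good vertices outnumber \<open>R\<close> times the
    number \<open>2 ^ (j * T)\<close> of possible neighbourhoods in \<open>X\<close>.\<close>
  obtain N2 :: nat where N2: "real N2 > 2 * (real R * 2 ^ (j * T) + 1) / \<epsilon>" using reals_Archimedean2 by blast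
  show ?case
  proof (intro exI[of _ "max N1 N2"] allI impI)
    fix U :: "'v set" and E
    assume U: "finite U" "max N1 N2 \<le> card U" and symE: "symp E" and irrE: "irreflp E"
      and degE: "has_min_degree E U (1 - 1 / real k + \<epsilon>)"
    have sym: "\<forall>x y. E x y \<longrightarrow> E y x" and irr: "\<forall>x. \<not> E x x"
      using symE irrE by (auto simp: symp_def irreflp_def)
    have deg: "\<forall>v\<in>U. real (card {y\<in>U. E v y}) \<ge> (1 - 1 / real k + \<epsilon>) * real (card U)"
      using degE by (simp add: has_min_degree_def)
    obtain A where A: "joined_blocks E U j T A" using N1 U symE irrE degE by fastforce
    define n where "n = real (card U)"
    define X where "X = (\<Union>l<j. A l)"
    have AU: "A l \<subseteq> U" "card (A l) = T" "finite (A l)" if "l < j" for l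
      using A that U(1) finite_subset by (auto simp: joined_blocks_def)
    have AE: "E x y" if "l < j" "l' < j" "l \<noteq> l'" "x \<in> A l" "y \<in> A l'" for l l' x y
      using A that by (auto simp: joined_blocks_def)
    have disj: "A l \<inter> A l' = {}" if "l < j" "l' < j" "l \<noteq> l'" for l l'
      using AE[OF that] irr by blast
    have finX: "finite X" and XU: "X \<subseteq> U" using AU by (auto simp: X_def)
    have cX: "card X = j * T"
      unfolding X_def using AU disj by (subst card_UN_disjoint) auto
    define N where "N = (\<lambda>u. {x\<in>X. E u x})"
    define good where "good = {u\<in>U. \<forall>l<j. card (N u \<inter> A l) \<ge> R}"
    have NX: "N u \<subseteq> X" "finite (N u)" for u using finX by (auto simp: N_def)
    have N_le: "card (N u) \<le> j * T" for u using card_mono[OF finX NX(1)] cX by simp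
    \<comment> \<open>Here \<open>m\<close> is j - 1: all classes but the deficient one may be seen
      completely.\<close>
    have N_bad: "real (card (N u)) \<le> real m * real T + real R" if u: "u \<in> U - good" for u
    proof -
      obtain l where l: "l < j" "card (N u \<inter> A l) < R" using u by (auto simp: good_def not_le)
      have "N u \<subseteq> (N u \<inter> A l) \<union> (X - A l)" using NX by auto
      then have "card (N u) \<le> card (N u \<inter> A l) + card (X - A l)"
        by (meson card_Un_le card_mono finX finite_Diff finite_Int finite_UnI NX(2) order_trans)
      also have "card (X - A l) = j * T - T"
        using l AU(2,3)[of l] cX by (subst card_Diff_subset) (auto simp: X_def)
      finally have "card (N u) \<le> R + m * T" using l by (simp add: j_def)
      then show ?thesis by (metis add.commute of_nat_add of_nat_le_iff of_nat_mult)
    qed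
    have "(real m * T + \<epsilon> * j * T) * n \<le> real (j * T) * ((1 - 1 / real k + \<epsilon>) * n)"
    proof -
      have "real m = real j * (1 - 1 / real j)" by (simp add: j_def field_simps)
      also have "\<dots> \<le> real j * (1 - 1 / real k)"
        using j by (intro mult_left_mono) (auto simp: field_simps)
      finally have "real m + \<epsilon> * j \<le> real j * (1 - 1 / real k + \<epsilon>)" by (simp add: algebra_simps)
      then have "(real m + \<epsilon> * j) * (T * n) \<le> real j * (1 - 1 / real k + \<epsilon>) * (T * n)"
        by (intro mult_right_mono) (auto simp: n_def)
      then show ?thesis by (simp add: algebra_simps)
    qed
    also have "\<dots> = (\<Sum>x\<in>X. (1 - 1 / real k + \<epsilon>) * n)" using cX by simp
    also have "\<dots> \<le> (\<Sum>x\<in>X. real (card {y\<in>U. E x y}))"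
      by (rule sum_mono) (use deg XU in \<open>auto simp: n_def\<close>)
    also have "\<dots> = (\<Sum>u\<in>U. real (card (N u)))"
    proof -
      have "(\<Sum>x\<in>X. real (card {y\<in>U. E x y})) = (\<Sum>x\<in>X. \<Sum>y\<in>U. if E x y then 1 else 0)"
        using U(1) by (simp add: sum.If_cases Int_def)
      also have "\<dots> = (\<Sum>y\<in>U. \<Sum>x\<in>X. if E x y then 1 else 0)" by (rule sum.swap)
      also have "\<dots> = (\<Sum>y\<in>U. real (card (N y)))"
      proof (rule sum.cong[OF refl])
        fix y
        have "{x\<in>X. E x y} = N y" using sym by (auto simp: N_def)
        then show "(\<Sum>x\<in>X. if E x y then 1 else 0) = real (card (N y))"
          using finX by (simp add: sum.If_cases Int_def)
      qed
      finally show ?thesis .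
    qed
    also have "\<dots> = (\<Sum>u\<in>U - good. real (card (N u))) + (\<Sum>u\<in>good. real (card (N u)))"
      by (rule sum.subset_diff) (use U in \<open>auto simp: good_def\<close>)
    also have "\<dots> \<le> (\<Sum>u\<in>U - good. real m * real T + real R) + (\<Sum>u\<in>good. real (j * T))"
      by (intro add_mono sum_mono N_bad) (simp_all only: of_nat_le_iff N_le)
    also have "\<dots> \<le> n * (real m * real T + real R) + real (card good) * real (j * T)"
    proof -
      have "real (card (U - good)) \<le> n" unfolding n_def using U by (intro of_nat_mono card_mono) auto
      then have "real (card (U - good)) * (real m * real T + real R) \<le> n * (real m * real T + real R)"
        by (intro mult_right_mono) auto
      then show ?thesis by simp
    qed
    finally have "\<epsilon> * (real j * T) * n \<le> n * real R + real (card good) * (real j * T)"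
      by (simp add: algebra_simps)
    moreover have "n * real R \<le> n * (\<epsilon> * (real j * T) / 2)"
    proof (rule mult_left_mono)
      have "1 * (\<epsilon> * T) \<le> real j * (\<epsilon> * T)" using j \<epsilon> Tpos by (intro mult_right_mono) auto
      then show "real R \<le> \<epsilon> * (real j * T) / 2" using \<epsilon>T by (simp add: mult_ac)
    qed (simp add: n_def)
    ultimately have "(\<epsilon> / 2 * n) * (real j * T) \<le> real (card good) * (real j * T)"
      by (simp add: algebra_simps)
    then have good_ge: "\<epsilon> / 2 * n \<le> real (card good)" using Tpos j by simp
    moreover have "\<epsilon> / 2 * n > real R * 2 ^ (j * T) + 1"
    proof -
      have "n \<ge> real N2" using U by (simp add: n_def)
      then have "n > 2 * (real R * 2 ^ (j * T) + 1) / \<epsilon>" using N2 by linarith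
      then show ?thesis using \<epsilon> by (simp add: field_simps)
    qed
    ultimately have many: "real (card good) > real R * 2 ^ (j * T) + 1" by linarith
    have fg: "finite good" using U by (simp add: good_def)
    have "N \<in> good \<rightarrow> Pow X" using NX by auto
    then obtain Y where Y: "Y \<in> Pow X" "card (N -` {Y} \<inter> good) * card (Pow X) \<ge> card good"
      using pigeonhole_card[of N good "Pow X"] fg finX by auto
    have "card (N -` {Y} \<inter> good) \<ge> R"
    proof (rule ccontr)
      assume "\<not> ?thesis"
      then have "card (N -` {Y} \<inter> good) * card (Pow X) \<le> R * card (Pow X)" by (intro mult_right_mono) auto
      then have "card good \<le> R * card (Pow X)" using Y(2) by linarith
      then have "card good \<le> R * 2 ^ (j * T)" using finX cX by (simp add: card_Pow)
      then have "real (card good) \<le> real (R * 2 ^ (j * T))" by (rule of_nat_mono)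
      then show False using many by simp
    qed
    then obtain Bj where Bj: "Bj \<subseteq> N -` {Y} \<inter> good" "card Bj = R" using obtain_subset_with_card_n by metis
    show "\<exists>A. joined_blocks E U (Suc (Suc m)) R A"
    proof (cases "Bj = {}")
      \<comment> \<open>An empty \<open>Bj\<close> means \<open>R = 0\<close>, where empty classes
        will do.\<close>
      case True
      then show ?thesis using Bj by (intro exI[of _ "\<lambda>_. {}"]) (auto simp: joined_blocks_def)
    next
      case False
      then obtain u0 where u0: "u0 \<in> good" "N u0 = Y" using Bj by auto
      have "\<exists>B. B \<subseteq> Y \<inter> A l \<and> card B = R" if "l < j" for l
      proof -
        have "R \<le> card (Y \<inter> A l)" using u0 that by (auto simp: good_def)
        from obtain_subset_with_card_n[OF this] show ?thesis by metis
      qed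
      then obtain B where B: "\<And>l. l < j \<Longrightarrow> B l \<subseteq> Y \<inter> A l" "\<And>l. l < j \<Longrightarrow> card (B l) = R" by metis
      have BjE: "E u x" "E x u" if "u \<in> Bj" "x \<in> Y" for u x
      proof -
        have "x \<in> N u" using that Bj by auto
        then show "E u x" "E x u" using sym by (auto simp: N_def)
      qed
      have "joined_blocks E U (Suc j) R (\<lambda>l. if l < j then B l else Bj)"
        unfolding joined_blocks_def
      proof (intro conjI allI impI ballI)
        fix l assume "l < Suc j"
        show "(if l < j then B l else Bj) \<subseteq> U" using B(1)[of l] AU(1)[of l] Bj by (auto simp: good_def)
        show "card (if l < j then B l else Bj) = R" using B(2)[of l] Bj by auto
      next
        fix l l' x y
        assume ll: "l < Suc j" "l' < Suc j" "l \<noteq> l'" and xy: "x \<in> (if l < j then B l else Bj)" "y \<in> (if l' < j then B l' else Bj)"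
        consider "l < j" "l' < j" | "l = j" "l' < j" | "l < j" "l' = j" using ll by linarith
        then show "E x y"
        proof cases
          case 1
          then show ?thesis using AE[OF 1 ll(3), of x y] B(1)[OF 1(1)] B(1)[OF 1(2)] xy by auto
        next
          case 2
          then show ?thesis using BjE(1)[of x y] B(1)[of l'] xy by auto
        next
          case 3
          then show ?thesis using BjE(2)[of y x] B(1)[of l] xy by auto
        qed
      qed
      then show ?thesis unfolding j_def by blast
    qed
  qed
qed

text \<open>Average degree is traded for minimum degree on a subset whose size is still proportional
  to that of \<open>U0\<close>.\<close>

lemma erdos_stone:
  fixes k R :: nat and \<epsilon> :: real
  assumes k: "k \<ge> 1" and \<epsilon>: "\<epsilon> > 0" "\<epsilon> \<le> 1"
  shows "\<exists>M0. \<forall>U :: 'v set. \<forall>E. finite U \<longrightarrow> card U \<ge> M0 \<longrightarrow> symp E \<longrightarrow> irreflp E \<longrightarrow>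
     real (card {(x, y) \<in> U \<times> U. E x y}) \<ge> (1 - 1 / real k + \<epsilon>) * (real (card U))\<^sup>2 \<longrightarrow> (\<exists>A. joined_blocks E U (Suc k) R A)"
proof -
  obtain N where N: "\<forall>U :: 'v set. \<forall>E. finite U \<longrightarrow> card U \<ge> N \<longrightarrow> symp E \<longrightarrow> irreflp E \<longrightarrow>
     has_min_degree E U (1 - 1 / real k + \<epsilon> / 4) \<longrightarrow> (\<exists>A. joined_blocks E U (Suc k) R A)"
    using joined_blocks_of_min_degree[OF k, of "\<epsilon> / 4" k R] \<epsilon> by auto
  \<comment> \<open>The bound 8/\<epsilon> absorbs the -1 in the degree bound: with \<alpha> at most
    2, the loss \<alpha> is at most a quarter of \<epsilon> times the size of
    \<open>U\<close>.\<close>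
  define L where "L = max (real N) (8 / \<epsilon>)"
  obtain M0 :: nat where M0: "real M0 > L / (\<epsilon> / 2)" using reals_Archimedean2 by blast
  show ?thesis
  proof (intro exI[of _ M0] allI impI)
    fix U0 :: "'v set" and E
    assume U0: "finite U0" "card U0 \<ge> M0" and symE: "symp E" and irrE: "irreflp E"
      and dense: "real (card {(x, y) \<in> U0 \<times> U0. E x y}) \<ge> (1 - 1 / real k + \<epsilon>) * (real (card U0))\<^sup>2"
    \<comment> \<open>Half of \<epsilon> pays for the size of the subset, a quarter for the -1 in
      its degree bound, and a quarter remains.\<close>
    define \<alpha> where "\<alpha> = 1 - 1 / real k + \<epsilon> / 2"
    have "1 / real k \<le> 1" "1 / real k \<ge> 0" using k by auto
    then have \<alpha>: "\<alpha> \<ge> 0" "\<alpha> \<le> 2" using \<epsilon> unfolding \<alpha>_def by linarith+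
    have "real (card {(x, y) \<in> U0 \<times> U0. E x y}) \<ge> (\<alpha> + \<epsilon> / 2) * (real (card U0))\<^sup>2"
    proof -
      have "\<alpha> + \<epsilon> / 2 = 1 - 1 / real k + \<epsilon>" by (simp add: \<alpha>_def)
      then show ?thesis using dense by (simp only:)
    qed
    from large_min_degree_subset[OF U0(1) sympD[OF symE] \<alpha>(1) this] obtain U where U: "U \<subseteq> U0"
      and big: "(real (card U))\<^sup>2 \<ge> \<epsilon> / 2 * (real (card U0))\<^sup>2"
      and deg: "\<forall>v\<in>U. real (card {y\<in>U. E v y}) \<ge> \<alpha> * (real (card U) - 1)" by blast
    have "(\<epsilon> / 2 * real (card U0))\<^sup>2 \<le> \<epsilon> / 2 * (real (card U0))\<^sup>2"
    proof -
      have "(\<epsilon> / 2) * (\<epsilon> / 2) \<le> \<epsilon> / 2 * 1" using \<epsilon> by (intro mult_left_mono) auto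
      then have "(\<epsilon> / 2) * (\<epsilon> / 2) * (real (card U0))\<^sup>2 \<le> \<epsilon> / 2 * (real (card U0))\<^sup>2" by (intro mult_right_mono) auto
      then show ?thesis by (simp add: power_mult_distrib power2_eq_square mult_ac)
    qed
    then have "(\<epsilon> / 2 * real (card U0))\<^sup>2 \<le> (real (card U))\<^sup>2" using big by linarith
    then have "\<epsilon> / 2 * real (card U0) \<le> real (card U)" by (rule power2_le_imp_le) simp
    moreover have "\<epsilon> / 2 * real (card U0) > L"
    proof -
      have "real (card U0) > L / (\<epsilon> / 2)" using M0 U0(2) by linarith
      then show ?thesis using \<epsilon> by (simp add: field_simps)
    qed
    ultimately have UL: "real (card U) > L" by linarith
    have "\<epsilon> * real (card U) \<ge> 8"
    proof -
      have "real (card U) \<ge> 8 / \<epsilon>" using UL by (simp add: L_def)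
      then show ?thesis using \<epsilon> by (simp add: field_simps)
    qed
    moreover have "\<alpha> * (real (card U) - 1) = (\<alpha> - \<epsilon> / 4) * real (card U) + (\<epsilon> * real (card U) / 4 - \<alpha>)"
      by (simp add: algebra_simps)
    moreover have "\<alpha> - \<epsilon> / 4 = 1 - 1 / real k + \<epsilon> / 4" by (simp add: \<alpha>_def)
    ultimately have "(1 - 1 / real k + \<epsilon> / 4) * real (card U) \<le> \<alpha> * (real (card U) - 1)"
      using \<alpha>(2) by simp
    then have "has_min_degree E U (1 - 1 / real k + \<epsilon> / 4)"
      using deg unfolding has_min_degree_def by fastforce
    moreover have "card U \<ge> N" using UL by (simp add: L_def)
    ultimately obtain A where "joined_blocks E U (Suc k) R A"
      using N[rule_format, OF finite_subset[OF U U0(1)] _ symE irrE] by metis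
    then have "joined_blocks E U0 (Suc k) R A"
      using U unfolding joined_blocks_def by (meson order_trans)
    then show "\<exists>A. joined_blocks E U0 (Suc k) R A" by (rule exI[of _ A])
  qed
qed

section \<open>Density of copies in a block function with many gray pairs\<close>

lemma card_PiE_fixed:
  assumes "finite I" "K \<subseteq> I" "\<And>l. l \<in> K \<Longrightarrow> y l \<in> V"
  shows "card {x \<in> I \<rightarrow>\<^sub>E V. \<forall>l\<in>K. x l = y l} = card V ^ card (I - K)"
proof -
  have "{x \<in> I \<rightarrow>\<^sub>E V. \<forall>l\<in>K. x l = y l} = (\<Pi>\<^sub>E l\<in>I. if l \<in> K then {y l} else V)"
    (is "?A = ?B")
  proof (intro equalityI subsetI)
    fix x assume "x \<in> ?A"
    then show "x \<in> ?B" by (auto simp: PiE_iff)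
  next
    fix x assume x: "x \<in> ?B"
    have "x l \<in> V \<and> (l \<in> K \<longrightarrow> x l = y l)" if "l \<in> I" for l
      using PiE_mem[OF x that] assms(3)[of l] by (auto split: if_splits)
    then show "x \<in> ?A" using x assms(2) by (auto simp: PiE_iff)
  qed
  then have "card {x \<in> I \<rightarrow>\<^sub>E V. \<forall>l\<in>K. x l = y l} = (\<Prod>l\<in>I. card (if l \<in> K then {y l} else V))"
    using assms(1) by (simp add: card_PiE)
  also have "\<dots> = (\<Prod>l\<in>I. if l \<in> K then 1 else card V)" by (rule prod.cong) auto
  also have "\<dots> = card V ^ card (I - K)"
    using assms(1) by (simp add: prod.If_cases Diff_eq)
  finally show ?thesis .
qed

text \<open>First moment: the mean number of \<Gamma>-pairs in a sample of \<open>M\<close> points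
  is at least \<beta> M (M - 1). No sample has more than M^2, so samples close to the mean cannot be
  rare. Points are drawn with repetition, and pairs of distinct indices are counted.\<close>

lemma dense_samples:
  fixes \<Gamma> :: "'v \<Rightarrow> 'v \<Rightarrow> bool" and M :: nat
  assumes V: "finite V" and \<beta>: "\<gamma> \<le> \<beta>" "\<beta> \<le> 1" "\<gamma> > 0"
    and dense: "real (card {(x, y) \<in> V \<times> V. \<Gamma> x y}) \<ge> \<beta> * (real (card V))\<^sup>2"
    and M: "real M * \<gamma> \<ge> 4"
  shows "real (card {x \<in> {..<M} \<rightarrow>\<^sub>E V.
      real (card {(i, j) \<in> {..<M} \<times> {..<M}. i \<noteq> j \<and> \<Gamma> (x i) (x j)}) \<ge> (\<beta> - \<gamma> / 2) * (real M)\<^sup>2})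
    \<ge> \<gamma> / 4 * real (card V) ^ M"
proof -
  define n where "n = real (card V)"
  define X where "X = ({..<M} \<rightarrow>\<^sub>E V)"
  define N where "N = (\<lambda>x. {(i, j) \<in> {..<M} \<times> {..<M}. i \<noteq> j \<and> \<Gamma> (x i) (x j)})"
  define good where "good = {x \<in> X. real (card (N x)) \<ge> (\<beta> - \<gamma> / 2) * (real M)\<^sup>2}"
  have finX: "finite X" and cX: "real (card X) = n ^ M"
    using V by (auto simp: X_def n_def card_funcsetE finite_PiE)
  have Mpos: "M \<ge> 2"
  proof (rule ccontr)
    assume "\<not> M \<ge> 2"
    then have "real M * \<gamma> \<le> 1 * 1" using \<beta> by (intro mult_mono) auto
    then show False using M by simp
  qed
  have N_le: "real (card (N x)) \<le> (real M)\<^sup>2" for x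
  proof -
    have "card (N x) \<le> card ({..<M} \<times> {..<M})" by (rule card_mono) (auto simp: N_def)
    then have "real (card (N x)) \<le> real (M * M)" by (intro of_nat_mono) simp
    then show ?thesis by (simp add: power2_eq_square)
  qed
  have pair: "real (card {x \<in> X. \<Gamma> (x i) (x j)}) \<ge> \<beta> * n ^ M" if ij: "i < M" "j < M" "i \<noteq> j" for i j
  proof -
    let ?E = "{(a, b) \<in> V \<times> V. \<Gamma> a b}"
    have finE: "finite ?E" by (rule finite_subset[of _ "V \<times> V"]) (use V in auto)
    have "card {x \<in> X. \<Gamma> (x i) (x j)} = card (\<Union>e\<in>?E. {x \<in> X. x i = fst e \<and> x j = snd e})"
      by (rule arg_cong[of _ _ card]) (use ij in \<open>auto simp: X_def PiE_iff\<close>)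
    also have "\<dots> = (\<Sum>e\<in>?E. card {x \<in> X. x i = fst e \<and> x j = snd e})"
      by (rule card_UN_disjoint[OF finE]) (use finX in \<open>auto simp: prod_eq_iff\<close>)
    also have "\<dots> = (\<Sum>e\<in>?E. card V ^ (M - 2))"
    proof (rule sum.cong[OF refl])
      fix e assume e: "e \<in> ?E"
      have "card {x \<in> {..<M} \<rightarrow>\<^sub>E V. \<forall>l\<in>{i, j}. x l = (if l = i then fst e else snd e)} = card V ^ card ({..<M} - {i, j})"
        by (rule card_PiE_fixed) (use ij e in auto)
      then show "card {x \<in> X. x i = fst e \<and> x j = snd e} = card V ^ (M - 2)"
        using ij by (simp add: X_def card_Diff_subset numeral_2_eq_2)
    qed
    finally have "real (card {x \<in> X. \<Gamma> (x i) (x j)}) = real (card ?E) * n ^ (M - 2)" by (simp add: n_def)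
    also have "\<dots> \<ge> (\<beta> * n\<^sup>2) * n ^ (M - 2)"
      using dense by (intro mult_right_mono) (auto simp: n_def)
    also have "(\<beta> * n\<^sup>2) * n ^ (M - 2) = \<beta> * n ^ M"
    proof -
      have "n\<^sup>2 * n ^ (M - 2) = n ^ M" using Mpos by (metis power_add le_add_diff_inverse)
      then show ?thesis by (simp only: mult.assoc)
    qed
    finally show ?thesis .
  qed
  let ?D = "{(i, j) \<in> {..<M} \<times> {..<M}. i \<noteq> j}"
  have finD: "finite ?D" by (rule finite_subset[of _ "{..<M} \<times> {..<M}"]) auto
  have cD: "real (card ?D) = real M * (real M - 1)"
  proof -
    have "?D = (SIGMA i:{..<M}. {..<M} - {i})" by auto
    then have "card ?D = (\<Sum>i<M. card ({..<M} - {i}))" by (simp only:) (subst card_SigmaI, auto)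
    also have "\<dots> = M * (M - 1)" by simp
    finally show ?thesis using Mpos by (simp add: of_nat_diff)
  qed
  \<comment> \<open>The hypothesis on \<open>M\<close> makes the diagonal loss \<beta> M at most a
    quarter of \<gamma> M^2; another quarter is the gap that yields the good samples.\<close>
  have "(\<beta> - \<gamma> / 4) * (real M)\<^sup>2 * n ^ M \<le> real M * (real M - 1) * (\<beta> * n ^ M)"
  proof -
    have "\<beta> * real M \<le> \<gamma> / 4 * (real M)\<^sup>2"
    proof -
      have "\<beta> * real M \<le> 1 * real M" using \<beta> by (intro mult_right_mono) auto
      also have "\<dots> \<le> (real M * \<gamma> / 4) * real M" using M by (intro mult_right_mono) auto
      finally show ?thesis by (simp add: power2_eq_square mult_ac)
    qed
    then have "(\<beta> - \<gamma> / 4) * (real M)\<^sup>2 \<le> real M * (real M - 1) * \<beta>"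
      by (simp add: algebra_simps power2_eq_square)
    then have "(\<beta> - \<gamma> / 4) * (real M)\<^sup>2 * n ^ M \<le> real M * (real M - 1) * \<beta> * n ^ M"
      by (intro mult_right_mono) (auto simp: n_def)
    then show ?thesis by (simp add: mult.assoc)
  qed
  also have "\<dots> = (\<Sum>e\<in>?D. \<beta> * n ^ M)" by (simp only: sum_constant cD)
  also have "\<dots> \<le> (\<Sum>e\<in>?D. real (card {x \<in> X. \<Gamma> (x (fst e)) (x (snd e))}))"
    by (rule sum_mono) (use pair in auto)
  also have "\<dots> = (\<Sum>e\<in>?D. \<Sum>x\<in>X. if \<Gamma> (x (fst e)) (x (snd e)) then 1 else 0)"
    using finX by (simp add: sum.If_cases Int_def)
  also have "\<dots> = (\<Sum>x\<in>X. \<Sum>e\<in>?D. if \<Gamma> (x (fst e)) (x (snd e)) then 1 else 0)" by (rule sum.swap)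
  also have "\<dots> = (\<Sum>x\<in>X. real (card (N x)))"
  proof (rule sum.cong[OF refl])
    fix x
    have "(\<Sum>e\<in>?D. if \<Gamma> (x (fst e)) (x (snd e)) then 1 else (0::real)) = real (card {e\<in>?D. \<Gamma> (x (fst e)) (x (snd e))})"
      using finD by (simp add: sum.If_cases Int_def)
    also have "{e\<in>?D. \<Gamma> (x (fst e)) (x (snd e))} = N x" by (auto simp: N_def)
    finally show "(\<Sum>e\<in>?D. if \<Gamma> (x (fst e)) (x (snd e)) then 1 else 0) = real (card (N x))" .
  qed
  also have "\<dots> = (\<Sum>x\<in>X - good. real (card (N x))) + (\<Sum>x\<in>good. real (card (N x)))"
    by (rule sum.subset_diff) (use finX in \<open>auto simp: good_def\<close>)
  also have "\<dots> \<le> (\<Sum>x\<in>X - good. (\<beta> - \<gamma> / 2) * (real M)\<^sup>2) + (\<Sum>x\<in>good. (real M)\<^sup>2)"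
    by (intro add_mono sum_mono N_le) (auto simp: good_def)
  also have "\<dots> \<le> n ^ M * ((\<beta> - \<gamma> / 2) * (real M)\<^sup>2) + real (card good) * (real M)\<^sup>2"
  proof -
    have "real (card (X - good)) \<le> n ^ M" unfolding cX[symmetric] using finX by (intro of_nat_mono card_mono) auto
    then have "real (card (X - good)) * ((\<beta> - \<gamma> / 2) * (real M)\<^sup>2) \<le> n ^ M * ((\<beta> - \<gamma> / 2) * (real M)\<^sup>2)"
      using \<beta> by (intro mult_right_mono) auto
    then show ?thesis by simp
  qed
  finally have "\<gamma> / 4 * n ^ M * (real M)\<^sup>2 \<le> real (card good) * (real M)\<^sup>2" by (simp add: algebra_simps)
  then have "\<gamma> / 4 * n ^ M \<le> real (card good)" using Mpos by simp
  then show ?thesis by (simp add: good_def N_def X_def n_def)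
qed

text \<open>The property minimised in the definition of the binary chromatic number, for the graph with
  adjacency \<open>EH\<close> on \<open>{..<h}\<close>; \<open>lab u\<close> is the index of the part containing \<open>u\<close>.\<close>

definition binary_colourable :: "nat \<Rightarrow> (nat \<Rightarrow> nat \<Rightarrow> bool) \<Rightarrow> nat \<Rightarrow> bool" where
  "binary_colourable h EH m \<longleftrightarrow> (\<forall>c\<le>m. \<exists>lab. (\<forall>u<h. lab u < m) \<and>
     (\<forall>u<h. \<forall>v<h. u \<noteq> v \<longrightarrow> lab u = lab v \<longrightarrow> EH u v = (lab u < c)))"

text \<open>Partitions list their clique parts first, while Ramsey's theorem yields clique and
  independent classes in any order; \<sigma> renumbers the classes accordingly.\<close>

lemma ex_inj_sorting_predicate:
  fixes \<tau> :: "nat \<Rightarrow> bool"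
  shows "\<exists>\<sigma> c. c \<le> m \<and> inj_on \<sigma> {..<m} \<and> (\<forall>l<m. \<sigma> l < m \<and> (\<tau> (\<sigma> l) \<longleftrightarrow> l < c))"
proof -
  define P where "P = {l. l < m \<and> \<tau> l}"
  define Q where "Q = {l. l < m \<and> \<not> \<tau> l}"
  have fin: "finite P" "finite Q" by (auto simp: P_def Q_def)
  have "P \<union> Q = {..<m}" "P \<inter> Q = {}" by (auto simp: P_def Q_def)
  then have m: "m = card P + card Q" using fin card_Un_disjoint by (metis card_lessThan)
  obtain f where f: "bij_betw f {..<card P} P" using ex_bij_betw_nat_finite[OF fin(1)] by (auto simp: atLeast0LessThan)
  obtain g where g: "bij_betw g {..<card Q} Q" using ex_bij_betw_nat_finite[OF fin(2)] by (auto simp: atLeast0LessThan)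
  define \<sigma> where "\<sigma> = (\<lambda>l. if l < card P then f l else g (l - card P))"
  have fP: "f l \<in> P" if "l < card P" for l using f that by (auto simp: bij_betw_def)
  have gQ: "g (l - card P) \<in> Q" if "l < m" "\<not> l < card P" for l using g that m by (auto simp: bij_betw_def)
  have \<sigma>P: "\<sigma> l < m \<and> (\<tau> (\<sigma> l) \<longleftrightarrow> l < card P)" if "l < m" for l
    using fP[of l] gQ[of l] that by (auto simp: \<sigma>_def P_def Q_def)
  have "inj_on \<sigma> {..<m}"
  proof (rule inj_onI)
    fix a b assume ab: "a \<in> {..<m}" "b \<in> {..<m}" "\<sigma> a = \<sigma> b"
    then have same: "a < card P \<longleftrightarrow> b < card P" using \<sigma>P[of a] \<sigma>P[of b] by auto
    show "a = b"
    proof (cases "a < card P")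
      case True
      then show ?thesis using same ab f by (auto simp: \<sigma>_def bij_betw_def inj_on_def)
    next
      case False
      then have "g (a - card P) = g (b - card P)" "a - card P < card Q" "b - card P < card Q"
        using same ab m by (auto simp: \<sigma>_def)
      then have "a - card P = b - card P" using g by (auto simp: bij_betw_def inj_on_def)
      then show ?thesis using False same by linarith
    qed
  qed
  then show ?thesis using \<sigma>P m by (intro exI[of _ \<sigma>] exI[of _ "card P"]) auto
qed

text \<open>\<open>F\<close> is the threshold graph of \<open>w\<close> at 1/2. Inside a clique of
  \<open>F\<close> edges have weight at least 1/2, inside an independent set non-edges do, and
  \<eta> is at most 1/2; between classes grayness serves both.\<close>

lemma embed_in_joined_blocks:
  fixes w :: "nat \<Rightarrow> nat \<Rightarrow> real"
  assumes col: "binary_colourable h EH m"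
    and blocks: "joined_blocks E U m R A" and U: "finite U"
    and R: "\<forall>(V :: nat set) (F :: nat set set). finite V \<and> card V \<ge> R \<longrightarrow>
      (\<exists>B\<subseteq>V. card B = h \<and> clique B F \<or> card B = h \<and> indep B F)"
    and w: "\<And>i j. w i j = w j i" and E: "\<And>i j. E i j \<Longrightarrow> \<eta> \<le> w i j \<and> w i j \<le> 1 - \<eta>" "\<And>i. \<not> E i i"
    and \<eta>: "\<eta> \<le> 1 / 2"
  shows "\<exists>\<phi>. inj_on \<phi> {..<h} \<and> \<phi> ` {..<h} \<subseteq> U \<and>
    (\<forall>u<h. \<forall>v<h. u \<noteq> v \<longrightarrow> \<eta> \<le> (if EH u v then w (\<phi> u) (\<phi> v) else 1 - w (\<phi> u) (\<phi> v)))"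
proof -
  define F where "F = {{i, j} | i j. w i j \<ge> 1 / 2}"
  have F: "{i, j} \<in> F \<longleftrightarrow> w i j \<ge> 1 / 2" for i j using w by (auto simp: F_def doubleton_eq_iff)
  have A: "A l \<subseteq> U" "card (A l) = R" if "l < m" for l using blocks that by (auto simp: joined_blocks_def)
  have "\<exists>B. B \<subseteq> A l \<and> card B = h \<and> (clique B F \<or> indep B F)" if "l < m" for l
  proof -
    have "finite (A l) \<and> card (A l) \<ge> R" using A[OF that] U finite_subset by auto
    with R have "\<exists>B\<subseteq>A l. card B = h \<and> clique B F \<or> card B = h \<and> indep B F" by simp
    then show ?thesis by blast
  qed
  then obtain B where B: "\<And>l. l < m \<Longrightarrow> B l \<subseteq> A l" "\<And>l. l < m \<Longrightarrow> card (B l) = h"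
      "\<And>l. l < m \<Longrightarrow> clique (B l) F \<or> indep (B l) F" by metis
  from ex_inj_sorting_predicate[of m "\<lambda>l. clique (B l) F"] obtain \<sigma> c where c: "c \<le> m"
    and \<sigma>: "inj_on \<sigma> {..<m}" and "\<forall>l<m. \<sigma> l < m \<and> (clique (B (\<sigma> l)) F \<longleftrightarrow> l < c)"
    by (elim exE conjE)
  then have \<sigma>m: "\<And>l. l < m \<Longrightarrow> \<sigma> l < m" and \<sigma>c: "\<And>l. l < m \<Longrightarrow> clique (B (\<sigma> l)) F \<longleftrightarrow> l < c"
    by simp_all
  from col[unfolded binary_colourable_def, rule_format, OF c] obtain lab where "\<forall>u<h. lab u < m"
    and "\<forall>u<h. \<forall>v<h. u \<noteq> v \<longrightarrow> lab u = lab v \<longrightarrow> EH u v = (lab u < c)"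
    by (elim exE conjE)
  then have lab: "\<And>u. u < h \<Longrightarrow> lab u < m"
      "\<And>u v. u < h \<Longrightarrow> v < h \<Longrightarrow> u \<noteq> v \<Longrightarrow> lab u = lab v \<Longrightarrow> EH u v = (lab u < c)"
    by simp_all
  have "\<exists>g. bij_betw g {..<h} (B l)" if "l < m" for l
  proof -
    have "finite (B l)" by (rule finite_subset[OF subset_trans[OF B(1)[OF that] A(1)[OF that]] U])
    from ex_bij_betw_nat_finite[OF this] B(2)[OF that] show ?thesis by (auto simp: atLeast0LessThan)
  qed
  then obtain g where g: "\<And>l. l < m \<Longrightarrow> bij_betw (g l) {..<h} (B l)" by metis
  \<comment> \<open>Every class has room for all \<open>h\<close> vertices, so \<open>u\<close>
    always takes place number \<open>u\<close> in its class, and vertices with equal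
    \<open>lab\<close> never collide.\<close>
  define \<phi> where "\<phi> = (\<lambda>u. g (\<sigma> (lab u)) u)"
  have \<phi>B: "\<phi> u \<in> B (\<sigma> (lab u))" if "u < h" for u
    using g[OF \<sigma>m[OF lab(1)[OF that]]] that by (auto simp: \<phi>_def bij_betw_def)
  have \<phi>A: "\<phi> u \<in> A (\<sigma> (lab u))" if "u < h" for u
    using B(1)[OF \<sigma>m[OF lab(1)[OF that]]] \<phi>B[OF that] by (rule subsetD)
  have cross: "E (\<phi> u) (\<phi> v)" if uv: "u < h" "v < h" "lab u \<noteq> lab v" for u v
  proof -
    have "\<sigma> (lab u) \<noteq> \<sigma> (lab v)" using \<sigma> lab(1) uv by (auto simp: inj_on_def)
    with blocks[unfolded joined_blocks_def] \<phi>A[OF uv(1)] \<phi>A[OF uv(2)] show ?thesis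
      using \<sigma>m[OF lab(1)[OF uv(1)]] \<sigma>m[OF lab(1)[OF uv(2)]] by simp
  qed
  have inj: "inj_on \<phi> {..<h}"
  proof (rule inj_onI)
    fix u v assume uv: "u \<in> {..<h}" "v \<in> {..<h}" "\<phi> u = \<phi> v"
    then have "lab u = lab v" using cross[of u v] E(2) by auto
    then show "u = v" using g[OF \<sigma>m[OF lab(1)[of v]]] uv by (auto simp: \<phi>_def bij_betw_def inj_on_def)
  qed
  moreover have "\<phi> ` {..<h} \<subseteq> U"
    using subsetD[OF A(1)[OF \<sigma>m[OF lab(1)]] \<phi>A] by auto
  moreover have "\<eta> \<le> (if EH u v then w (\<phi> u) (\<phi> v) else 1 - w (\<phi> u) (\<phi> v))"
    if uv: "u < h" "v < h" "u \<noteq> v" for u v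
  proof (cases "lab u = lab v")
    case True
    have ne: "\<phi> u \<noteq> \<phi> v" using inj uv by (auto simp: inj_on_def)
    have mem: "\<phi> u \<in> B (\<sigma> (lab u))" "\<phi> v \<in> B (\<sigma> (lab u))" using \<phi>B[OF uv(1)] \<phi>B[OF uv(2)] True by simp_all
    show ?thesis
    proof (cases "lab u < c")
      case lc: True
      then have "clique (B (\<sigma> (lab u))) F" using \<sigma>c[OF lab(1)[OF uv(1)]] by simp
      then have "{\<phi> u, \<phi> v} \<in> F" using mem ne unfolding clique_def by blast
      then show ?thesis using F lab(2)[OF uv True] lc \<eta> by auto
    next
      case lc: False
      then have "indep (B (\<sigma> (lab u))) F" using \<sigma>c[OF lab(1)[OF uv(1)]] B(3)[OF \<sigma>m[OF lab(1)[OF uv(1)]]] by simp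
      then have "{\<phi> u, \<phi> v} \<notin> F" using mem ne unfolding indep_def by blast
      then show ?thesis using F lab(2)[OF uv True] lc \<eta> by auto
    qed
  next
    case False
    then show ?thesis using E(1)[OF cross[OF uv(1,2)]] by auto
  qed
  ultimately show ?thesis by blast
qed

text \<open>Double counting of samples of \<open>M\<close> points. A fixed proportion of them have
  enough gray pairs to contain a tuple of \<open>h\<close> points on which every factor is at least
  \<eta>, and a given tuple lies in at most M^h n^(M - h) samples; so a fixed proportion of all
  tuples is good. \<open>M\<close> and \<open>c0\<close> are chosen before \<open>V\<close> and
  \<open>W\<close>.\<close>

lemma positive_density_of_dense_gray:
  fixes k h :: nat and EH :: "nat \<Rightarrow> nat \<Rightarrow> bool" and \<eta> \<gamma> :: real
  assumes col: "binary_colourable h EH (Suc k)" and k: "k \<ge> 1"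
    and \<eta>: "0 < \<eta>" "\<eta> \<le> 1 / 2" and \<gamma>: "0 < \<gamma>" "\<gamma> \<le> 1 / real k"
  shows "\<exists>c0>0. \<forall>(V :: 'v set) W. finite V \<longrightarrow> (\<forall>x y. W x y = W y x) \<longrightarrow> (\<forall>x y. 0 \<le> W x y \<and> W x y \<le> 1) \<longrightarrow>
     real (card {(x, y) \<in> V \<times> V. \<eta> \<le> W x y \<and> W x y \<le> 1 - \<eta>}) \<ge> (1 - 1 / real k + \<gamma>) * (real (card V))\<^sup>2 \<longrightarrow>
     (\<Sum>z\<in>{..<h} \<rightarrow>\<^sub>E V. \<Prod>(u, v)\<in>{(u, v). u \<in> {..<h} \<and> v \<in> {..<h} \<and> u < v}.
        if EH u v then W (z u) (z v) else 1 - W (z u) (z v)) \<ge> c0 * real (card V) ^ h"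
proof -
  let ?S = "{(u, v). u \<in> {..<h} \<and> v \<in> {..<h} \<and> u < v}"
  obtain R where R: "\<forall>(V :: nat set) (F :: nat set set). finite V \<and> card V \<ge> R \<longrightarrow>
      (\<exists>B\<subseteq>V. card B = h \<and> clique B F \<or> card B = h \<and> indep B F)"
    using ramsey2[where 'a = nat, of h h] by blast
  have k1: "1 / real k \<le> 1" using k by simp
  obtain M0 where M0: "\<forall>U :: nat set. \<forall>E. finite U \<longrightarrow> card U \<ge> M0 \<longrightarrow> symp E \<longrightarrow> irreflp E \<longrightarrow>
     real (card {(x, y) \<in> U \<times> U. E x y}) \<ge> (1 - 1 / real k + \<gamma> / 2) * (real (card U))\<^sup>2 \<longrightarrow>
     (\<exists>A. joined_blocks E U (Suc k) R A)"
    using erdos_stone[where 'v = nat, OF k, of "\<gamma> / 2" R] \<gamma> k1 by auto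
  obtain M1 :: nat where M1: "real M1 > 4 / \<gamma>" using reals_Archimedean2 by blast
  \<comment> \<open>\<open>M0\<close> serves Erdos-Stone, \<open>M1\<close> serves the sampling
    bound, and \<open>M \<ge> h\<close> keeps \<open>M - h\<close> from being truncated.\<close>
  define M where "M = M0 + M1 + h + 1"
  have M: "M \<ge> M0" "M \<ge> h" "M \<ge> 1" by (auto simp: M_def)
  have "real M \<ge> 4 / \<gamma>" using M1 by (simp add: M_def)
  then have M\<gamma>: "real M * \<gamma> \<ge> 4" using \<gamma> by (simp add: field_simps)
  define c0 where "c0 = \<eta> ^ card ?S * (\<gamma> / 4 / real M ^ h)"
  have "c0 > 0" using \<eta> \<gamma> M by (simp add: c0_def)
  moreover have "(\<Sum>z\<in>{..<h} \<rightarrow>\<^sub>E V. \<Prod>(u, v)\<in>?S. if EH u v then W (z u) (z v) else 1 - W (z u) (z v)) \<ge> c0 * real (card V) ^ h"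
    if V: "finite V" and Wsym: "\<forall>x y. W x y = W y x" and W01: "\<forall>x y. 0 \<le> W x y \<and> W x y \<le> 1"
      and dense: "real (card {(x, y) \<in> V \<times> V. \<eta> \<le> W x y \<and> W x y \<le> 1 - \<eta>}) \<ge> (1 - 1 / real k + \<gamma>) * (real (card V))\<^sup>2"
    for V :: "'v set" and W
  proof -
    define n where "n = real (card V)"
    define wt where "wt = (\<lambda>z. \<lambda>(u, v). if EH u v then W (z u) (z v) else 1 - W (z u) (z v))"
    define goodz where "goodz = {z \<in> {..<h} \<rightarrow>\<^sub>E V. \<forall>e\<in>?S. \<eta> \<le> wt z e}"
    define goodx where "goodx = {x \<in> {..<M} \<rightarrow>\<^sub>E V.
      real (card {(i, j) \<in> {..<M} \<times> {..<M}. i \<noteq> j \<and> \<eta> \<le> W (x i) (x j) \<and> W (x i) (x j) \<le> 1 - \<eta>})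
       \<ge> (1 - 1 / real k + \<gamma> - \<gamma> / 2) * (real M)\<^sup>2}"
    define \<Phi> where "\<Phi> = {\<phi> \<in> {..<h} \<rightarrow>\<^sub>E {..<M}. inj_on \<phi> {..<h}}"
    have fin\<Phi>: "finite \<Phi>" and c\<Phi>: "card \<Phi> \<le> M ^ h"
    proof -
      have "finite ({..<h} \<rightarrow>\<^sub>E {..<M})" "card ({..<h} \<rightarrow>\<^sub>E {..<M}) = M ^ h"
        by (auto simp: finite_PiE card_funcsetE)
      then show "finite \<Phi>" "card \<Phi> \<le> M ^ h"
        using card_mono[of "{..<h} \<rightarrow>\<^sub>E {..<M}" \<Phi>] by (auto simp: \<Phi>_def)
    qed
    have finz: "finite goodz" using V by (simp add: goodz_def finite_PiE)
    have finx: "finite ({..<M} \<rightarrow>\<^sub>E V)" using V by (simp add: finite_PiE)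
    have gx: "real (card goodx) \<ge> \<gamma> / 4 * n ^ M"
      unfolding goodx_def n_def
      by (rule dense_samples[OF V _ _ \<gamma>(1) dense M\<gamma>]) (use \<gamma> k1 in auto)
    \<comment> \<open>The samples that show the tuple \<open>z\<close> at the positions \<phi>;
      injectivity of \<phi> fixes exactly \<open>h\<close> coordinates.\<close>
    define fibre where "fibre = (\<lambda>\<phi> z. {x \<in> {..<M} \<rightarrow>\<^sub>E V. \<forall>u<h. x (\<phi> u) = z u})"
    have "goodx \<subseteq> (\<Union>\<phi>\<in>\<Phi>. \<Union>z\<in>goodz. fibre \<phi> z)"
    proof
      fix x assume x: "x \<in> goodx"
      \<comment> \<open>The graph lives on the indices of the sample, not on its points; so it is
        irreflexive even where points repeat or W (x i) (x i) is gray.\<close>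
      define E where "E = (\<lambda>i j. i \<noteq> j \<and> \<eta> \<le> W (x i) (x j) \<and> W (x i) (x j) \<le> 1 - \<eta>)"
      have "symp E" "irreflp E" using Wsym by (auto simp: E_def symp_def irreflp_def)
      moreover have "real (card {(i, j) \<in> {..<M} \<times> {..<M}. E i j}) \<ge> (1 - 1 / real k + \<gamma> / 2) * (real (card {..<M}))\<^sup>2"
      proof -
        have "1 - 1 / real k + \<gamma> / 2 = 1 - 1 / real k + \<gamma> - \<gamma> / 2" by simp
        then show ?thesis using x unfolding goodx_def E_def by (simp only: card_lessThan mem_Collect_eq)
      qed
      ultimately obtain A where A: "joined_blocks E {..<M} (Suc k) R A"
        using M0[rule_format, of "{..<M}" E] M by auto
      obtain \<phi> where \<phi>: "inj_on \<phi> {..<h}" "\<phi> ` {..<h} \<subseteq> {..<M}"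
        and wt: "\<forall>u<h. \<forall>v<h. u \<noteq> v \<longrightarrow> \<eta> \<le> (if EH u v then W (x (\<phi> u)) (x (\<phi> v)) else 1 - W (x (\<phi> u)) (x (\<phi> v)))"
        using embed_in_joined_blocks[OF col A finite_lessThan R, of "\<lambda>i j. W (x i) (x j)" \<eta>] Wsym \<eta>
        unfolding E_def by blast
      define \<phi>' where "\<phi>' = restrict \<phi> {..<h}"
      define z where "z = restrict (\<lambda>u. x (\<phi> u)) {..<h}"
      have xV: "x i \<in> V" if "i < M" for i using x that by (auto simp: goodx_def)
      have "\<phi>' \<in> \<Phi>" using \<phi> by (auto simp: \<phi>'_def \<Phi>_def inj_on_def)
      moreover have "z \<in> goodz"
      proof -
        have "z \<in> {..<h} \<rightarrow>\<^sub>E V" using \<phi>(2) xV by (auto simp: z_def)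
        moreover have "\<eta> \<le> wt z e" if e: "e \<in> ?S" for e
        proof -
          obtain u v where uv: "e = (u, v)" "u < h" "v < h" "u \<noteq> v" using e by auto
          show ?thesis using wt[rule_format, OF uv(2-4)] uv by (simp add: wt_def z_def split: if_splits)
        qed
        ultimately show ?thesis by (simp add: goodz_def)
      qed
      moreover have "x \<in> fibre \<phi>' z" using x by (auto simp: fibre_def goodx_def \<phi>'_def z_def)
      ultimately show "x \<in> (\<Union>\<phi>\<in>\<Phi>. \<Union>z\<in>goodz. fibre \<phi> z)" by blast
    qed
    then have "card goodx \<le> card (\<Union>\<phi>\<in>\<Phi>. \<Union>z\<in>goodz. fibre \<phi> z)"
      by (rule card_mono[rotated]) (rule finite_subset[OF _ finx], auto simp: fibre_def)
    also have "\<dots> \<le> (\<Sum>\<phi>\<in>\<Phi>. \<Sum>z\<in>goodz. card (fibre \<phi> z))"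
      by (rule order_trans[OF card_UN_le[OF fin\<Phi>]], rule sum_mono, rule card_UN_le[OF finz])
    also have "\<dots> = (\<Sum>\<phi>\<in>\<Phi>. \<Sum>z\<in>goodz. card V ^ (M - h))"
    proof (intro sum.cong refl)
      fix \<phi> z assume \<phi>: "\<phi> \<in> \<Phi>" and z: "z \<in> goodz"
      have inj: "inj_on \<phi> {..<h}" and sub: "\<phi> ` {..<h} \<subseteq> {..<M}" using \<phi> by (auto simp: \<Phi>_def)
      let ?y = "\<lambda>l. z (inv_into {..<h} \<phi> l)"
      have y: "?y (\<phi> u) = z u" if "u < h" for u using inv_into_f_f[OF inj] that by simp
      have "fibre \<phi> z = {x \<in> {..<M} \<rightarrow>\<^sub>E V. \<forall>l\<in>\<phi> ` {..<h}. x l = ?y l}"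
        unfolding fibre_def using y by auto
      also have "card \<dots> = card V ^ card ({..<M} - \<phi> ` {..<h})"
      proof (rule card_PiE_fixed[OF _ sub])
        fix l assume "l \<in> \<phi> ` {..<h}"
        then obtain u where "u < h" "l = \<phi> u" by auto
        then show "?y l \<in> V" using y z by (auto simp: goodz_def)
      qed simp
      also have "card ({..<M} - \<phi> ` {..<h}) = M - h"
        using sub inj by (simp add: card_Diff_subset card_image)
      finally show "card (fibre \<phi> z) = card V ^ (M - h)" .
    qed
    also have "\<dots> = card \<Phi> * (card goodz * card V ^ (M - h))" by simp
    also have "\<dots> \<le> M ^ h * (card goodz * card V ^ (M - h))" using c\<Phi> by (rule mult_right_mono) simp
    finally have "real (card goodx) \<le> real (M ^ h * (card goodz * card V ^ (M - h)))" by (rule of_nat_mono)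
    then have "\<gamma> / 4 * n ^ M \<le> real M ^ h * real (card goodz) * n ^ (M - h)"
      using gx by (simp add: n_def mult.assoc)
    moreover have "n ^ M = n ^ h * n ^ (M - h)" using M by (simp flip: power_add)
    ultimately have *: "(\<gamma> / 4 * n ^ h) * n ^ (M - h) \<le> (real M ^ h * real (card goodz)) * n ^ (M - h)"
      by (simp add: mult.assoc)
    have gz: "\<gamma> / 4 / real M ^ h * n ^ h \<le> real (card goodz)"
    proof (cases "n = 0")
      case True
      show ?thesis
      \<comment> \<open>With \<open>V\<close> empty the right-hand power is \<open>0 ^ h\<close>,
        which is 1 for \<open>h = 0\<close>; then the empty tuple is good.\<close>
      proof (cases "h = 0")
        case True
        then have "goodz = {\<lambda>_. undefined}" by (auto simp: goodz_def)
        then show ?thesis using True \<gamma> k1 by simp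
      qed (use True in \<open>simp add: power_0_left\<close>)
    next
      case False
      then have "n > 0" by (simp add: n_def)
      then have "\<gamma> / 4 * n ^ h \<le> real M ^ h * real (card goodz)" using * by (simp add: mult_le_cancel_right)
      then show ?thesis using M by (simp add: field_simps)
    qed
    have nonneg: "0 \<le> prod (wt z) ?S" for z
      by (rule prod_nonneg) (use W01 in \<open>auto simp: wt_def\<close>)
    have "c0 * n ^ h = \<eta> ^ card ?S * (\<gamma> / 4 / real M ^ h * n ^ h)" by (simp add: c0_def)
    also have "\<dots> \<le> \<eta> ^ card ?S * real (card goodz)" using gz \<eta> by (intro mult_left_mono) auto
    also have "\<dots> = (\<Sum>z\<in>goodz. \<Prod>e\<in>?S. \<eta>)" by (simp add: mult.commute)
    also have "\<dots> \<le> (\<Sum>z\<in>goodz. prod (wt z) ?S)"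
      by (intro sum_mono prod_mono) (use \<eta> in \<open>auto simp: goodz_def\<close>)
    also have "\<dots> \<le> (\<Sum>z\<in>{..<h} \<rightarrow>\<^sub>E V. prod (wt z) ?S)"
      by (rule sum_mono2) (use V nonneg in \<open>auto simp: goodz_def finite_PiE\<close>)
    finally show ?thesis by (simp add: wt_def n_def)
  qed
  ultimately show ?thesis by blast
qed

section \<open>A quasirandom graph\<close>

text \<open>Entry of the Sylvester-Hadamard matrix (a Walsh character). The product form lets sums
  over all \<open>A\<close> factorise.\<close>

definition char_sign :: "nat set \<Rightarrow> nat set \<Rightarrow> real" where
  "char_sign A B = (\<Prod>a\<in>A. if a \<in> B then - 1 else 1)"

lemma char_sign_eq: "finite A \<Longrightarrow> char_sign A B = (- 1) ^ card (A \<inter> B)"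
  by (simp add: char_sign_def prod.If_cases)

lemma char_sign_commute: "finite A \<Longrightarrow> finite B \<Longrightarrow> char_sign A B = char_sign B A"
  by (simp add: char_sign_eq Int_commute)

lemma char_sign_cases: "finite A \<Longrightarrow> char_sign A B = 1 \<or> char_sign A B = - 1"
  by (cases "even (card (A \<inter> B))") (simp_all add: char_sign_eq)

text \<open>The sum over all subsets of \<open>D\<close> is the product of the factors 1 + f a, and
  an element in exactly one of \<open>B\<close> and \<open>C\<close> makes its factor
  vanish.\<close>

lemma char_sign_orthogonal:
  assumes D: "finite D" "B \<subseteq> D" "C \<subseteq> D"
  shows "(\<Sum>A\<in>Pow D. char_sign A B * char_sign A C) = (if B = C then 2 ^ card D else 0)"
proof (cases "B = C")
  case True
  have "char_sign A B * char_sign A B = 1" if "A \<in> Pow D" for A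
    using char_sign_cases[OF finite_subset[of A D], of B] that D by auto
  then have "(\<Sum>A\<in>Pow D. char_sign A B * char_sign A B) = (\<Sum>A\<in>Pow D. 1)" by (rule sum.cong[OF refl])
  then show ?thesis using True D by (simp add: card_Pow)
next
  case False
  define f where "f = (\<lambda>a. (if a \<in> B then - 1 else 1) * (if a \<in> C then - 1 else (1::real)))"
  have "(\<Sum>A\<in>Pow D. char_sign A B * char_sign A C) = (\<Sum>A\<in>Pow D. prod f A * prod (\<lambda>_. 1) (D - A))"
    by (simp add: char_sign_def f_def prod.distrib)
  also have "\<dots> = (\<Prod>a\<in>D. f a + 1)" by (rule prod_add[OF D(1), symmetric])
  also have "\<dots> = 0"
  proof -
    obtain a where "a \<in> D" "a \<in> B \<longleftrightarrow> a \<notin> C" using False D by blast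
    then have "a \<in> D" "f a + 1 = 0" by (auto simp: f_def)
    then show ?thesis using D(1) by (auto intro: prod_zero)
  qed
  finally show ?thesis using False by simp
qed

text \<open>Lindsey's lemma: Cauchy-Schwarz over the rows in \<open>\<S>\<close>, then extension to
  all rows, where orthogonality leaves only the diagonal terms.\<close>

lemma lindsey:
  assumes D: "finite D" and S: "\<S> \<subseteq> Pow D" and T: "\<T> \<subseteq> Pow D"
  shows "(\<Sum>A\<in>\<S>. \<Sum>B\<in>\<T>. char_sign A B)\<^sup>2 \<le> real (card \<S>) * real (card \<T>) * 2 ^ card D"
proof -
  have fT: "finite \<T>" using T D finite_subset by (metis finite_Pow_iff)
  have "(\<Sum>A\<in>\<S>. (\<Sum>B\<in>\<T>. char_sign A B)\<^sup>2) \<le> (\<Sum>A\<in>Pow D. (\<Sum>B\<in>\<T>. char_sign A B)\<^sup>2)"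
    by (rule sum_mono2) (use D S in auto)
  also have "\<dots> = (\<Sum>A\<in>Pow D. \<Sum>B\<in>\<T>. \<Sum>C\<in>\<T>. char_sign A B * char_sign A C)"
    by (simp add: power2_eq_square sum_product)
  also have "\<dots> = (\<Sum>B\<in>\<T>. \<Sum>A\<in>Pow D. \<Sum>C\<in>\<T>. char_sign A B * char_sign A C)" by (rule sum.swap)
  also have "\<dots> = (\<Sum>B\<in>\<T>. \<Sum>C\<in>\<T>. \<Sum>A\<in>Pow D. char_sign A B * char_sign A C)"
    by (rule sum.cong[OF refl], rule sum.swap)
  also have "\<dots> = (\<Sum>B\<in>\<T>. \<Sum>C\<in>\<T>. if B = C then 2 ^ card D else 0)"
    by (intro sum.cong refl char_sign_orthogonal[OF D]) (use T in auto)
  also have "\<dots> = real (card \<T>) * 2 ^ card D" using fT by simp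
  finally have "(\<Sum>A\<in>\<S>. (\<Sum>B\<in>\<T>. char_sign A B)\<^sup>2) \<le> real (card \<T>) * 2 ^ card D" .
  then have "(\<Sum>A\<in>\<S>. (\<Sum>B\<in>\<T>. char_sign A B)\<^sup>2) * real (card \<S>) \<le> real (card \<T>) * 2 ^ card D * real (card \<S>)"
    by (intro mult_right_mono) auto
  then show ?thesis
    using sum_squared_le_sum_of_squares[of "\<lambda>A. \<Sum>B\<in>\<T>. char_sign A B" \<S>] by (simp add: mult_ac)
qed

text \<open>Vertices are distinct subsets of a set of \<open>d\<close> elements, adjacent when their
  intersection is odd. Lindsey's lemma bounds sign sums by the square root of 2 n^3, at most
  \<gamma> n^2 by the first condition on \<open>n\<close>; signs count half, and the second
  condition lets the diagonal use the other half.\<close>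

lemma ex_quasirandom_graph:
  fixes \<gamma> :: real
  assumes \<gamma>: "\<gamma> > 0" and n: "real n \<ge> 2 / \<gamma>\<^sup>2" "real n \<ge> 2 / \<gamma>" "n \<ge> 1"
  shows "\<exists>E :: nat \<Rightarrow> nat \<Rightarrow> bool. symp E \<and> irreflp E \<and>
    (\<forall>S\<subseteq>{..<n}. \<forall>T\<subseteq>{..<n}. \<bar>\<Sum>x\<in>S. \<Sum>y\<in>T. (if E x y then 1 else 0) - 1 / 2\<bar> \<le> \<gamma> * (real n)\<^sup>2)"
proof -
  have "\<exists>d. n \<le> 2 ^ d \<and> 2 ^ d \<le> 2 * n"
    using n(3)
  proof (induction n rule: dec_induct)
    case base
    show ?case by (rule exI[of _ 0]) simp
  next
    case (step m)
    then obtain d where "m \<le> 2 ^ d" "2 ^ d \<le> 2 * m" by auto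
    then show ?case
      by (cases "m = 2 ^ d") (rule exI[of _ "Suc d"], simp, rule exI[of _ d], simp)
  qed
  then obtain d where d: "n \<le> 2 ^ d" "2 ^ d \<le> 2 * n" by auto
  define D where "D = {..<d}"
  have finD: "finite D" by (simp add: D_def)
  have "card {..<n} \<le> card (Pow D)" using d by (simp add: D_def card_Pow)
  then obtain g where g: "g ` {..<n} \<subseteq> Pow D" "inj_on g {..<n}"
    using card_le_inj[of "{..<n}" "Pow D"] finD by auto
  \<comment> \<open>Intersecting with \<open>D\<close> keeps the sets finite for arguments beyond
    \<open>n\<close> too, so symmetry and the values 1 and -1 hold everywhere.\<close>
  define s where "s = (\<lambda>x y. char_sign (g x \<inter> D) (g y \<inter> D))"
  have s_sym: "s x y = s y x" and s_val: "s x y = 1 \<or> s x y = - 1" for x y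
    using finD by (auto simp: s_def char_sign_commute char_sign_cases)
  define E where "E = (\<lambda>x y. x \<noteq> y \<and> s x y = - 1)"
  have "\<bar>\<Sum>x\<in>S. \<Sum>y\<in>T. (if E x y then 1 else 0) - 1 / 2\<bar> \<le> \<gamma> * (real n)\<^sup>2"
    if ST: "S \<subseteq> {..<n}" "T \<subseteq> {..<n}" for S T
  proof -
    have fin: "finite S" "finite T" using ST finite_subset by blast+
    have cST: "real (card S) \<le> n" "real (card T) \<le> n" using ST card_mono[of "{..<n}"] by auto
    have gD: "g x \<inter> D = g x" if "x < n" for x using g that by auto
    have inj: "inj_on g S" "inj_on g T" using g(2) ST inj_on_subset by blast+
    have "(\<Sum>x\<in>S. \<Sum>y\<in>T. s x y) = (\<Sum>x\<in>S. \<Sum>y\<in>T. char_sign (g x) (g y))"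
      unfolding s_def by (intro sum.cong refl) (use ST gD in \<open>simp add: subset_iff\<close>)
    also have "\<dots> = (\<Sum>A\<in>g ` S. \<Sum>B\<in>g ` T. char_sign A B)"
      using inj by (simp add: sum.reindex)
    finally have "(\<Sum>x\<in>S. \<Sum>y\<in>T. s x y)\<^sup>2 \<le> real (card (g ` S)) * real (card (g ` T)) * 2 ^ card D"
      using lindsey[OF finD subset_trans[OF image_mono[OF ST(1)] g(1)] subset_trans[OF image_mono[OF ST(2)] g(1)]]
      by (simp only:)
    also have "\<dots> \<le> real n * real n * (2 * real n)"
    proof (intro mult_mono)
      have "real (2 ^ d) \<le> real (2 * n)" using d(2) by (rule of_nat_mono)
      then show "2 ^ card D \<le> 2 * real n" by (simp add: D_def)
    qed (use inj cST in \<open>auto simp: card_image\<close>)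
    also have "\<dots> \<le> (\<gamma> * (real n)\<^sup>2)\<^sup>2"
    proof -
      have "2 \<le> real n * \<gamma>\<^sup>2" using n(1) \<gamma> by (simp add: field_simps)
      then have "2 * (real n) ^ 3 \<le> (real n * \<gamma>\<^sup>2) * (real n) ^ 3" by (intro mult_right_mono) auto
      then show ?thesis by (simp add: power2_eq_square power3_eq_cube mult_ac)
    qed
    finally have "(\<Sum>x\<in>S. \<Sum>y\<in>T. s x y)\<^sup>2 \<le> (\<gamma> * (real n)\<^sup>2)\<^sup>2" .
    then have s_le: "\<bar>\<Sum>x\<in>S. \<Sum>y\<in>T. s x y\<bar> \<le> \<gamma> * (real n)\<^sup>2"
      using \<gamma> by (simp add: abs_le_square_iff[symmetric])
    \<comment> \<open>Correction for the diagonal, where irreflexivity overrides the sign.\<close>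
    define r where "r = (\<lambda>x y. if x = y then s x y / 2 - 1 / 2 else 0)"
    have eq: "(if E x y then 1 else 0) - 1 / 2 = - (s x y / 2) + r x y" for x y
      using s_val[of x y] by (auto simp: E_def r_def)
    have "\<bar>\<Sum>x\<in>S. \<Sum>y\<in>T. r x y\<bar> \<le> (\<Sum>x\<in>S. \<Sum>y\<in>T. \<bar>r x y\<bar>)"
      by (rule order_trans[OF sum_abs], rule sum_mono, rule sum_abs)
    also have "\<dots> \<le> (\<Sum>x\<in>S. \<Sum>y\<in>T. if x = y then 1 else 0)"
    proof (intro sum_mono)
      fix x y show "\<bar>r x y\<bar> \<le> (if x = y then 1 else 0)" using s_val[of x y] by (auto simp: r_def)
    qed
    also have "\<dots> \<le> (\<Sum>x\<in>S. 1)" by (rule sum_mono) (use fin in simp)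
    also have "\<dots> \<le> real n" using cST by simp
    also have "\<dots> \<le> \<gamma> * (real n)\<^sup>2 / 2"
    proof -
      have "2 \<le> real n * \<gamma>" using n(2) \<gamma> by (simp add: field_simps)
      then have "2 * real n \<le> (real n * \<gamma>) * real n" by (intro mult_right_mono) auto
      then show ?thesis by (simp add: power2_eq_square mult_ac)
    qed
    finally have r_le: "\<bar>\<Sum>x\<in>S. \<Sum>y\<in>T. r x y\<bar> \<le> \<gamma> * (real n)\<^sup>2 / 2" .
    have "(\<Sum>x\<in>S. \<Sum>y\<in>T. (if E x y then 1 else 0) - 1 / 2) = - ((\<Sum>x\<in>S. \<Sum>y\<in>T. s x y) / 2) + (\<Sum>x\<in>S. \<Sum>y\<in>T. r x y)"
      unfolding eq by (simp add: sum.distrib sum_negf sum_subtractf sum_divide_distrib)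
    then show ?thesis using s_le r_le by linarith
  qed
  moreover have "symp E" "irreflp E" using s_sym by (auto simp: E_def symp_def irreflp_def)
  ultimately show ?thesis by blast
qed

section \<open>Induced copies near a quasirandom graph\<close>

text \<open>Union bound over the colliding pairs of coordinates; each collision costs one degree of
  freedom.\<close>

lemma card_non_injective_le:
  assumes V: "finite V"
  shows "card {z \<in> {..<h} \<rightarrow>\<^sub>E V. \<not> inj_on z {..<h}}
    \<le> card {(u, v). u \<in> {..<h} \<and> v \<in> {..<h} \<and> u < v} * card V ^ (h - 1)"
proof -
  let ?S = "{(u, v). u \<in> {..<h} \<and> v \<in> {..<h} \<and> u < v}"
  have finS: "finite ?S" by (rule finite_subset[of _ "{..<h} \<times> {..<h}"]) auto
  define C where "C = (\<lambda>(u, v). {z \<in> {..<h} \<rightarrow>\<^sub>E V. z u = z v})"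
  have finP: "finite ({..<h} \<rightarrow>\<^sub>E V)" using V by (simp add: finite_PiE)
  have "{z \<in> {..<h} \<rightarrow>\<^sub>E V. \<not> inj_on z {..<h}} \<subseteq> (\<Union>e\<in>?S. C e)"
  proof
    fix z assume z: "z \<in> {z \<in> {..<h} \<rightarrow>\<^sub>E V. \<not> inj_on z {..<h}}"
    then obtain u v where "u < h" "v < h" "u \<noteq> v" "z u = z v" by (auto simp: inj_on_def)
    then have "(min u v, max u v) \<in> ?S" "z \<in> C (min u v, max u v)"
      using z by (auto simp: C_def min_def max_def)
    then show "z \<in> (\<Union>e\<in>?S. C e)" by blast
  qed
  then have "card {z \<in> {..<h} \<rightarrow>\<^sub>E V. \<not> inj_on z {..<h}} \<le> card (\<Union>e\<in>?S. C e)"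
    by (rule card_mono[rotated]) (rule finite_subset[OF _ finP], auto simp: C_def)
  also have "\<dots> \<le> (\<Sum>e\<in>?S. card (C e))" by (rule card_UN_le[OF finS])
  also have "\<dots> \<le> (\<Sum>e\<in>?S. card V ^ (h - 1))"
  proof (rule sum_mono)
    fix e assume "e \<in> ?S"
    then obtain u v where e: "e = (u, v)" and uv: "u < h" "v < h" "u < v" by auto
    have "C e \<subseteq> (\<Union>a\<in>V. {z \<in> {..<h} \<rightarrow>\<^sub>E V. \<forall>l\<in>{u, v}. z l = a})"
      using uv by (auto simp: C_def e)
    then have "card (C e) \<le> card (\<Union>a\<in>V. {z \<in> {..<h} \<rightarrow>\<^sub>E V. \<forall>l\<in>{u, v}. z l = a})"
      by (rule card_mono[rotated]) (rule finite_subset[OF _ finP], auto)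
    also have "\<dots> \<le> (\<Sum>a\<in>V. card {z \<in> {..<h} \<rightarrow>\<^sub>E V. \<forall>l\<in>{u, v}. z l = a})"
      by (rule card_UN_le[OF V])
    also have "\<dots> = (\<Sum>a\<in>V. card V ^ (h - 2))"
    proof (rule sum.cong[OF refl])
      fix a assume "a \<in> V"
      then have "card {z \<in> {..<h} \<rightarrow>\<^sub>E V. \<forall>l\<in>{u, v}. z l = a} = card V ^ card ({..<h} - {u, v})"
        by (intro card_PiE_fixed) (use uv in auto)
      also have "card ({..<h} - {u, v}) = h - 2" using uv by (subst card_Diff_subset) auto
      finally show "card {z \<in> {..<h} \<rightarrow>\<^sub>E V. \<forall>l\<in>{u, v}. z l = a} = card V ^ (h - 2)" .
    qed
    also have "\<dots> = card V ^ Suc (h - 2)" by simp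
    also have "Suc (h - 2) = h - 1" using uv by linarith
    finally show "card (C e) \<le> card V ^ (h - 1)" .
  qed
  finally show ?thesis by simp
qed

text \<open>On each block the sum of f' - a differs from that of f - a by at most the edits inside
  the block, and the latter is at most \<open>B\<close> as a block is a rectangle. Summing over at
  most 4^m blocks bounds from below the number of edits needed to move the block means away from
  \<open>a\<close>.\<close>

lemma sum_abs_block_mean_diff_le:
  fixes c :: "'v \<Rightarrow> bool list" and f f' :: "'v \<times> 'v \<Rightarrow> real"
  assumes V: "finite V" and c: "\<And>x. length (c x) = m"
    and disc: "\<And>S T. S \<subseteq> V \<Longrightarrow> T \<subseteq> V \<Longrightarrow> \<bar>\<Sum>z\<in>S \<times> T. f z - a\<bar> \<le> B"
  shows "(\<Sum>z\<in>V \<times> V. \<bar>block_mean (V \<times> V) (map_prod c c) f' (map_prod c c z) - a\<bar>)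
    \<le> (\<Sum>z\<in>V \<times> V. \<bar>f z - f' z\<bar>) + 4 ^ m * B"
proof -
  let ?Z = "V \<times> V" and ?C = "map_prod c c"
  have finZ: "finite ?Z" using V by simp
  have B: "B \<ge> 0" using disc[of "{}" "{}"] by simp
  have block: "\<bar>\<Sum>z\<in>{z\<in>?Z. ?C z = l}. (f' z - a)\<bar> \<le> (\<Sum>z\<in>{z\<in>?Z. ?C z = l}. \<bar>f z - f' z\<bar>) + B" for l
  proof -
    have "{z\<in>?Z. ?C z = l} = {x\<in>V. c x = fst l} \<times> {y\<in>V. c y = snd l}" by (cases l) auto
    then have "\<bar>\<Sum>z\<in>{z\<in>?Z. ?C z = l}. f z - a\<bar> \<le> B" using disc[of "{x\<in>V. c x = fst l}" "{y\<in>V. c y = snd l}"] by auto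
    moreover have "(\<Sum>z\<in>{z\<in>?Z. ?C z = l}. (f' z - a)) = (\<Sum>z\<in>{z\<in>?Z. ?C z = l}. f z - a) - (\<Sum>z\<in>{z\<in>?Z. ?C z = l}. f z - f' z)"
      by (simp add: sum_subtractf)
    moreover have "\<bar>\<Sum>z\<in>{z\<in>?Z. ?C z = l}. f z - f' z\<bar> \<le> (\<Sum>z\<in>{z\<in>?Z. ?C z = l}. \<bar>f z - f' z\<bar>)" by (rule sum_abs)
    ultimately show ?thesis by linarith
  qed
  have labels: "real (card (?C ` ?Z)) \<le> 4 ^ m"
  proof -
    let ?L = "{xs :: bool list. set xs \<subseteq> UNIV \<and> length xs = m}"
    have "finite ?L" by (rule finite_lists_length_eq) simp
    moreover have "card ?L = 2 ^ m" using card_lists_length_eq[of "UNIV :: bool set" m] by simp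
    moreover have "?C ` ?Z \<subseteq> ?L \<times> ?L" using c by auto
    ultimately have "card (?C ` ?Z) \<le> 2 ^ m * 2 ^ m"
      using card_mono[of "?L \<times> ?L" "?C ` ?Z"] by (simp add: card_cartesian_product)
    also have "\<dots> = 4 ^ m" by (simp flip: power_mult_distrib)
    finally have "real (card (?C ` ?Z)) \<le> real (4 ^ m)" by (rule of_nat_mono)
    then show ?thesis by simp
  qed
  have "(\<Sum>z\<in>?Z. \<bar>block_mean ?Z ?C f' (?C z) - a\<bar>) = (\<Sum>l\<in>?C ` ?Z. \<bar>\<Sum>z\<in>{z\<in>?Z. ?C z = l}. (f' z - a)\<bar>)"
    by (rule sum_abs_block_mean_diff[OF finZ])
  also have "\<dots> \<le> (\<Sum>l\<in>?C ` ?Z. (\<Sum>z\<in>{z\<in>?Z. ?C z = l}. \<bar>f z - f' z\<bar>) + B)"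
    by (rule sum_mono, rule block)
  also have "\<dots> = (\<Sum>z\<in>?Z. \<bar>f z - f' z\<bar>) + real (card (?C ` ?Z)) * B"
    using sum.image_gen[OF finZ, of "\<lambda>z. \<bar>f z - f' z\<bar>" ?C] by (simp only: sum.distrib sum_constant)
  also have "\<dots> \<le> (\<Sum>z\<in>?Z. \<bar>f z - f' z\<bar>) + 4 ^ m * B"
    using labels B by (intro add_left_mono mult_right_mono)
  finally show ?thesis .
qed

lemma induced_copy_near_quasirandom:
  fixes k h :: nat and EH :: "nat \<Rightarrow> nat \<Rightarrow> bool" and \<epsilon> :: real
  assumes col: "binary_colourable h EH (Suc k)" and k: "k \<ge> 1" and \<epsilon>: "0 < \<epsilon>" "\<epsilon> < 1"
  shows "\<exists>\<gamma>>0. \<exists>N. \<forall>(V :: 'v set) E E'. finite V \<longrightarrow> card V \<ge> N \<longrightarrow> symp E' \<longrightarrow>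
     (\<forall>S\<subseteq>V. \<forall>T\<subseteq>V. \<bar>\<Sum>x\<in>S. \<Sum>y\<in>T. (if E x y then 1 else 0) - 1 / 2\<bar> \<le> \<gamma> * (real (card V))\<^sup>2) \<longrightarrow>
     real (card {(x, y) \<in> V \<times> V. E x y \<noteq> E' x y}) \<le> (1 - \<epsilon>) * (real (card V))\<^sup>2 / (2 * real k) \<longrightarrow>
     (\<exists>z. inj_on z {..<h} \<and> z ` {..<h} \<subseteq> V \<and> (\<forall>u<h. \<forall>v<h. u < v \<longrightarrow> E' (z u) (z v) = EH u v))"
proof -
  let ?S = "{(u, v). u \<in> {..<h} \<and> v \<in> {..<h} \<and> u < v}"
  have finS: "finite ?S" by (rule finite_subset[of _ "{..<h} \<times> {..<h}"]) auto
  define p where "p = real (card ?S)"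
  \<comment> \<open>A pair that is not gray contributes at least 1/2 - \<eta> = (1 - \<epsilon>/4)/2
    to an L1 distance of at most (1 - \<epsilon>/2) n^2/(2k). As (1 - \<epsilon>/4)^2 is at least 1
    - \<epsilon>/2, one factor cancels and at most (1 - \<epsilon>/4) n^2/k pairs are not
    gray.\<close>
  define \<eta> where "\<eta> = \<epsilon> / 8"
  have \<eta>: "0 < \<eta>" "\<eta> \<le> 1 / 2" using \<epsilon> by (auto simp: \<eta>_def)
  have kp: "real k > 0" using k by simp
  have \<gamma>1: "0 < \<epsilon> / (4 * real k)" "\<epsilon> / (4 * real k) \<le> 1 / real k" using \<epsilon> kp by (auto simp: field_simps)
  obtain c0 where c0: "c0 > 0" and dens: "\<forall>(V :: 'v set) W. finite V \<longrightarrow> (\<forall>x y. W x y = W y x) \<longrightarrow> (\<forall>x y. 0 \<le> W x y \<and> W x y \<le> 1) \<longrightarrow>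
     real (card {(x, y) \<in> V \<times> V. \<eta> \<le> W x y \<and> W x y \<le> 1 - \<eta>}) \<ge> (1 - 1 / real k + \<epsilon> / (4 * real k)) * (real (card V))\<^sup>2 \<longrightarrow>
     (\<Sum>z\<in>{..<h} \<rightarrow>\<^sub>E V. \<Prod>(u, v)\<in>?S. if EH u v then W (z u) (z v) else 1 - W (z u) (z v)) \<ge> c0 * real (card V) ^ h"
    using positive_density_of_dense_gray[where 'v = 'v, OF col k \<eta> \<gamma>1] by (elim exE conjE)
  \<comment> \<open>The counting lemma then loses at most half of \<open>c0\<close>;
    \<open>p + 1\<close> avoids division by zero when \<open>H\<close> has at most one pair of
    vertices to count.\<close>
  define \<delta> where "\<delta> = c0 / (2 * (p + 1))"
  have p: "p \<ge> 0" by (simp add: p_def)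
  have \<delta>: "\<delta> > 0" using c0 p by (simp add: \<delta>_def)
  have p\<delta>: "p * \<delta> \<le> c0 / 2" using c0 p by (simp add: \<delta>_def field_simps)
  obtain J :: nat where "real J > 1 / \<delta>\<^sup>2" using reals_Archimedean2 by blast
  then have J: "real J * \<delta>\<^sup>2 > 1" using \<delta> by (simp add: field_simps)
  \<comment> \<open>At most 4^(2 J) pairs of cells each contribute a discrepancy of \<gamma> n^2, in
    total \<epsilon> n^2/(4k).\<close>
  define \<gamma> where "\<gamma> = \<epsilon> / (4 * real k) / 4 ^ (2 * J)"
  have \<gamma>: "\<gamma> > 0" unfolding \<gamma>_def using \<gamma>1(1) by (rule divide_pos_pos) simp
  \<comment> \<open>From here on the at most p n^(h - 1) non-injective tuples cannot account for a
    weight of c0 n^h / 2.\<close>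
  obtain N :: nat where N: "real N > 2 * (p + 1) / c0" using reals_Archimedean2 by blast
  have main: "\<exists>z. inj_on z {..<h} \<and> z ` {..<h} \<subseteq> V \<and> (\<forall>u<h. \<forall>v<h. u < v \<longrightarrow> E' (z u) (z v) = EH u v)"
    if V: "finite V" "card V \<ge> N" and sym: "symp E'"
      and disc: "\<forall>S\<subseteq>V. \<forall>T\<subseteq>V. \<bar>\<Sum>x\<in>S. \<Sum>y\<in>T. (if E x y then 1 else 0) - 1 / 2\<bar> \<le> \<gamma> * (real (card V))\<^sup>2"
      and edits: "real (card {(x, y) \<in> V \<times> V. E x y \<noteq> E' x y}) \<le> (1 - \<epsilon>) * (real (card V))\<^sup>2 / (2 * real k)"
    for V :: "'v set" and E E'
  proof -
    define n where "n = real (card V)"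
    have nN: "n > 2 * (p + 1) / c0" using N V(2) by (simp add: n_def)
    have npos: "n > 0" using nN c0 p by (smt (verit) divide_nonneg_pos)
    then have Vne: "V \<noteq> {}" by (auto simp: n_def)
    let ?Z = "V \<times> V"
    have finZ: "finite ?Z" using V by simp
    define f :: "'v \<times> 'v \<Rightarrow> real" where "f = (\<lambda>(x, y). if E x y then 1 else 0)"
    define f' :: "'v \<times> 'v \<Rightarrow> real" where "f' = (\<lambda>(x, y). if E' x y then 1 else 0)"
    have f'_swap: "f' (x, y) = f' (y, x)" for x y using sym by (auto simp: f'_def symp_def)
    have f'01: "0 \<le> f' z \<and> f' z \<le> 1" for z by (cases z) (auto simp: f'_def)
    \<comment> \<open>It is the edited graph that is regularised, since the copy of \<open>H\<close>
      is sought there; the quasirandom one needs only its discrepancy.\<close>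
    from weak_regularity[of V f' \<delta> J, OF V(1) Vne f'01 \<delta> J] obtain c :: "'v \<Rightarrow> bool list" and j where j: "j \<le> J"
      and len: "\<forall>x. length (c x) = 2 * j"
      and reg: "\<forall>S\<subseteq>V. \<forall>T\<subseteq>V. \<bar>\<Sum>z\<in>S \<times> T. f' z - block_mean ?Z (map_prod c c) f' (map_prod c c z)\<bar> \<le> \<delta> * n\<^sup>2"
      unfolding n_def by (elim exE conjE)
    define W where "W = (\<lambda>x y. block_mean ?Z (map_prod c c) f' (c x, c y))"
    have Wsym: "\<forall>x y. W x y = W y x" unfolding W_def using block_mean_swap[of f' V c, OF f'_swap] by blast
    have W01: "\<forall>x y. 0 \<le> W x y \<and> W x y \<le> 1" unfolding W_def by (intro allI conjI block_mean_bounds f'01)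
    have "(\<Sum>z\<in>?Z. \<bar>block_mean ?Z (map_prod c c) f' (map_prod c c z) - 1 / 2\<bar>) \<le> (\<Sum>z\<in>?Z. \<bar>f z - f' z\<bar>) + 4 ^ (2 * j) * (\<gamma> * n\<^sup>2)"
    proof (rule sum_abs_block_mean_diff_le[OF V(1)])
      show "length (c x) = 2 * j" for x using len by simp
      fix S T assume "S \<subseteq> V" "T \<subseteq> V"
      then show "\<bar>\<Sum>z\<in>S \<times> T. f z - 1 / 2\<bar> \<le> \<gamma> * n\<^sup>2"
        using disc by (simp add: f_def n_def sum.cartesian_product case_prod_unfold)
    qed
    moreover have "(\<Sum>z\<in>?Z. \<bar>f z - f' z\<bar>) = real (card {(x, y) \<in> ?Z. E x y \<noteq> E' x y})"
    proof -
      have "(\<Sum>z\<in>?Z. \<bar>f z - f' z\<bar>) = (\<Sum>z\<in>?Z. if E (fst z) (snd z) \<noteq> E' (fst z) (snd z) then 1 else 0)"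
        by (rule sum.cong[OF refl]) (auto simp: f_def f'_def)
      also have "\<dots> = real (card {z\<in>?Z. E (fst z) (snd z) \<noteq> E' (fst z) (snd z)})"
        using finZ by (simp add: sum.If_cases Int_def)
      also have "{z\<in>?Z. E (fst z) (snd z) \<noteq> E' (fst z) (snd z)} = {(x, y) \<in> ?Z. E x y \<noteq> E' x y}" by auto
      finally show ?thesis .
    qed
    moreover have "4 ^ (2 * j) * (\<gamma> * n\<^sup>2) \<le> \<epsilon> / (4 * real k) * n\<^sup>2"
    proof -
      have "(4::real) ^ (2 * j) \<le> 4 ^ (2 * J)" using j by (intro power_increasing) auto
      then have "4 ^ (2 * j) * (\<gamma> * n\<^sup>2) \<le> 4 ^ (2 * J) * (\<gamma> * n\<^sup>2)" using \<gamma> by (intro mult_right_mono) auto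
      also have "\<dots> = \<epsilon> / (4 * real k) * n\<^sup>2" by (simp add: \<gamma>_def)
      finally show ?thesis .
    qed
    ultimately have L1: "(\<Sum>z\<in>?Z. \<bar>W (fst z) (snd z) - 1 / 2\<bar>) \<le> (1 - \<epsilon>) * n\<^sup>2 / (2 * real k) + \<epsilon> / (4 * real k) * n\<^sup>2"
      using edits by (simp add: W_def n_def map_prod_def case_prod_unfold)
    define gray where "gray = {(x, y) \<in> ?Z. \<eta> \<le> W x y \<and> W x y \<le> 1 - \<eta>}"
    have gray_sub: "gray \<subseteq> ?Z" by (auto simp: gray_def)
    have cZ: "real (card ?Z) = n\<^sup>2" by (simp add: n_def power2_eq_square card_cartesian_product)
    have "(n\<^sup>2 - real (card gray)) * (1 / 2 - \<eta>) = (\<Sum>z\<in>?Z - gray. 1 / 2 - \<eta>)"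
    proof -
      have "real (card (?Z - gray)) = n\<^sup>2 - real (card gray)"
        using gray_sub finZ cZ by (simp add: card_Diff_subset finite_subset of_nat_diff card_mono)
      then show ?thesis by simp
    qed
    also have "\<dots> \<le> (\<Sum>z\<in>?Z - gray. \<bar>W (fst z) (snd z) - 1 / 2\<bar>)"
      by (rule sum_mono) (auto simp: gray_def)
    also have "\<dots> \<le> (\<Sum>z\<in>?Z. \<bar>W (fst z) (snd z) - 1 / 2\<bar>)"
      by (rule sum_mono2) (use finZ in auto)
    also note L1
    also have "(1 - \<epsilon>) * n\<^sup>2 / (2 * real k) + \<epsilon> / (4 * real k) * n\<^sup>2 = (1 - \<epsilon> / 2) * (n\<^sup>2 / (2 * real k))"
      using kp by (simp add: field_simps)
    also have "\<dots> \<le> (1 - \<epsilon> / 4) * (1 - \<epsilon> / 4) * (n\<^sup>2 / (2 * real k))"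
    proof (rule mult_right_mono)
      have "(1 - \<epsilon> / 4) * (1 - \<epsilon> / 4) = (1 - \<epsilon> / 2) + (\<epsilon> / 4) * (\<epsilon> / 4)" by (simp add: algebra_simps)
      then show "1 - \<epsilon> / 2 \<le> (1 - \<epsilon> / 4) * (1 - \<epsilon> / 4)" by simp
    qed simp
    also have "1 / 2 - \<eta> = (1 - \<epsilon> / 4) * (1 / 2)" by (simp add: \<eta>_def)
    finally have "(1 - \<epsilon> / 4) * ((n\<^sup>2 - real (card gray)) / 2) \<le> (1 - \<epsilon> / 4) * ((1 - \<epsilon> / 4) * (n\<^sup>2 / (2 * real k)))"
      by (simp add: mult_ac)
    then have "(n\<^sup>2 - real (card gray)) / 2 \<le> (1 - \<epsilon> / 4) * (n\<^sup>2 / (2 * real k))"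
      by (rule mult_left_le_imp_le) (use \<epsilon> in simp)
    then have "n\<^sup>2 - 2 * ((1 - \<epsilon> / 4) * (n\<^sup>2 / (2 * real k))) \<le> real (card gray)"
      by (simp only: pos_divide_le_eq zero_less_numeral diff_le_eq mult.commute add.commute)
    moreover have "(1 - 1 / real k + \<epsilon> / (4 * real k)) * n\<^sup>2 = n\<^sup>2 - 2 * ((1 - \<epsilon> / 4) * (n\<^sup>2 / (2 * real k)))"
      using kp by (simp add: field_simps)
    ultimately have "real (card gray) \<ge> (1 - 1 / real k + \<epsilon> / (4 * real k)) * n\<^sup>2" by simp
    then have lower: "(\<Sum>z\<in>{..<h} \<rightarrow>\<^sub>E V. \<Prod>(u, v)\<in>?S. if EH u v then W (z u) (z v) else 1 - W (z u) (z v)) \<ge> c0 * n ^ h"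
      unfolding gray_def n_def
      by (rule dens[THEN spec, THEN spec, THEN mp, THEN mp, THEN mp, THEN mp, OF V(1) Wsym W01])
    \<comment> \<open>Non-edges of \<open>H\<close> carry the weight 1 - w; complementing both
      functions only flips the sign of their difference, so the cut norm bound is unchanged.\<close>
    define F where "F = (\<lambda>w :: 'v \<Rightarrow> 'v \<Rightarrow> real. \<lambda>e x y. if EH (fst e) (snd e) then w x y else 1 - w x y)"
    define w' where "w' = (\<lambda>x y. f' (x, y))"
    have "\<bar>(\<Sum>z\<in>{..<h} \<rightarrow>\<^sub>E V. \<Prod>(u, v)\<in>?S. F W (u, v) (z u) (z v)) - (\<Sum>z\<in>{..<h} \<rightarrow>\<^sub>E V. \<Prod>(u, v)\<in>?S. F w' (u, v) (z u) (z v))\<bar>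
      \<le> real (card ?S) * \<delta> * real (card V) ^ card {..<h}"
    proof (rule counting_lemma[OF _ V(1) order_refl])
      fix e A B assume AB: "A \<subseteq> V" "B \<subseteq> V"
      have *: "\<bar>\<Sum>x\<in>A. \<Sum>y\<in>B. w' x y - W x y\<bar> \<le> \<delta> * n\<^sup>2"
        using reg[rule_format, OF AB] by (simp add: W_def w'_def sum.cartesian_product case_prod_unfold map_prod_def)
      have **: "(\<Sum>x\<in>A. \<Sum>y\<in>B. W x y - w' x y) = - (\<Sum>x\<in>A. \<Sum>y\<in>B. w' x y - W x y)"
        by (simp flip: sum_negf)
      show "\<bar>\<Sum>x\<in>A. \<Sum>y\<in>B. F W e x y - F w' e x y\<bar> \<le> \<delta> * (real (card V))\<^sup>2"
        using * ** by (cases "EH (fst e) (snd e)") (simp_all add: F_def n_def)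
    next
      fix e x y
      show "0 \<le> F W e x y \<and> F W e x y \<le> 1" using W01 by (simp add: F_def)
      show "0 \<le> F w' e x y \<and> F w' e x y \<le> 1" using f'01 by (simp add: F_def w'_def)
    qed simp
    moreover have "(\<Sum>z\<in>{..<h} \<rightarrow>\<^sub>E V. \<Prod>(u, v)\<in>?S. F W (u, v) (z u) (z v)) \<ge> c0 * n ^ h"
      using lower by (simp add: F_def)
    moreover have "real (card ?S) * \<delta> * real (card V) ^ card {..<h} \<le> c0 / 2 * n ^ h"
    proof -
      have "p * \<delta> * n ^ h \<le> c0 / 2 * n ^ h" using p\<delta> npos by (intro mult_right_mono) auto
      then show ?thesis by (simp add: p_def n_def)
    qed
    ultimately have big: "(\<Sum>z\<in>{..<h} \<rightarrow>\<^sub>E V. \<Prod>(u, v)\<in>?S. F w' (u, v) (z u) (z v)) \<ge> c0 / 2 * n ^ h" by linarith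
    \<comment> \<open>Since \<open>w'\<close> takes only the values 0 and 1, \<open>P\<close> is the
      indicator of the tuples that respect all adjacencies of \<open>H\<close>.\<close>
    define P where "P = (\<lambda>z. \<Prod>(u, v)\<in>?S. F w' (u, v) (z u) (z v))"
    have P01: "0 \<le> P z" "P z \<le> 1" for z
      unfolding P_def using f'01 by (auto intro!: prod_nonneg prod_le_1 simp: F_def w'_def)
    have "\<exists>z\<in>{..<h} \<rightarrow>\<^sub>E V. inj_on z {..<h} \<and> P z \<noteq> 0"
    proof (rule ccontr)
      assume none: "\<not> ?thesis"
      let ?X = "{..<h} \<rightarrow>\<^sub>E V" and ?B = "{z \<in> {..<h} \<rightarrow>\<^sub>E V. \<not> inj_on z {..<h}}"
      have finX: "finite ?X" using V by (simp add: finite_PiE)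
      have "(\<Sum>z\<in>?X. P z) = (\<Sum>z\<in>?B. P z)"
        by (rule sum.mono_neutral_right) (use none finX in auto)
      also have "\<dots> \<le> (\<Sum>z\<in>?B. 1)" by (rule sum_mono, rule P01)
      also have "\<dots> = real (card ?B)" by simp
      also have "\<dots> \<le> real (card ?S * card V ^ (h - 1))" by (rule of_nat_mono, rule card_non_injective_le[OF V(1)])
      also have "\<dots> = p * n ^ (h - 1)" by (simp add: p_def n_def)
      finally have le: "c0 / 2 * n ^ h \<le> p * n ^ (h - 1)" using big by (simp add: P_def)
      show False
      proof (cases h)
        case 0
        then have "p = 0" by (simp add: p_def)
        then show False using le 0 c0 by simp
      next
        case (Suc h')
        then have "(c0 / 2 * n) * n ^ h' \<le> p * n ^ h'" using le by (simp add: mult.assoc)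
        then have "c0 / 2 * n \<le> p" using npos by simp
        moreover have "c0 / 2 * n > p" using nN c0 by (simp add: field_simps)
        ultimately show False by simp
      qed
    qed
    then obtain z where z: "z \<in> {..<h} \<rightarrow>\<^sub>E V" "inj_on z {..<h}" "P z \<noteq> 0" by blast
    have "E' (z u) (z v) = EH u v" if uv: "u < h" "v < h" "u < v" for u v
    proof -
      have "F w' (u, v) (z u) (z v) \<noteq> 0"
        using z(3) finS uv by (auto simp: P_def prod_zero_iff)
      then show ?thesis by (auto simp: F_def w'_def f'_def split: if_splits)
    qed
    then show ?thesis using z by (intro exI[of _ z]) auto
  qed
  show ?thesis by (rule exI[of _ \<gamma>], rule conjI[OF \<gamma>], rule exI[of _ N], intro allI impI, rule main)
qed

section \<open>Distance to the family of H-free graphs\<close>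

lemma binary_colourable_of_partitions:
  assumes g: "bij_betw g {..<h} (verts H)"
    and part: "\<forall>c\<in>{0..m}. clique_coclique_partition H c (m - c)"
  shows "binary_colourable h (\<lambda>u v. {g u, g v} \<in> edges H) m"
  unfolding binary_colourable_def
proof (intro allI impI)
  fix c assume c: "c \<le> m"
  then have cm: "c + (m - c) = m" by simp
  from part c have "clique_coclique_partition H c (m - c)" by simp
  then obtain P where U: "(\<Union>i<m. P i) = verts H"
    and cl: "\<forall>i<c. is_clique H (P i)" and co: "\<forall>i\<in>{c..<m}. is_coclique H (P i)"
    unfolding clique_coclique_partition_def cm by auto
  have gv: "g u \<in> verts H" if "u < h" for u using g that by (auto simp: bij_betw_def)
  then have "\<exists>i. i < m \<and> g u \<in> P i" if "u < h" for u using U that by blast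
  then obtain lab where lab: "\<And>u. u < h \<Longrightarrow> lab u < m \<and> g u \<in> P (lab u)" by metis
  show "\<exists>lab. (\<forall>u<h. lab u < m) \<and>
     (\<forall>u<h. \<forall>v<h. u \<noteq> v \<longrightarrow> lab u = lab v \<longrightarrow> ({g u, g v} \<in> edges H) = (lab u < c))"
  proof (intro exI[of _ lab] conjI allI impI)
    fix u v assume uv: "u < h" "v < h" "u \<noteq> v" "lab u = lab v"
    have ne: "g u \<noteq> g v" using g uv by (auto simp: bij_betw_def inj_on_def)
    show "({g u, g v} \<in> edges H) = (lab u < c)"
    proof (cases "lab u < c")
      case True
      then have "is_clique H (P (lab u))" using cl by blast
      then show ?thesis using lab[OF uv(1)] lab[OF uv(2)] uv ne True unfolding is_clique_def by auto
    next
      case False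
      then have "is_coclique H (P (lab u))" using co lab[OF uv(1)] by auto
      then show ?thesis using lab[OF uv(1)] lab[OF uv(2)] uv False unfolding is_coclique_def by auto
    qed
  qed (use lab in blast)
qed

lemma induced_copy_of_embedding:
  fixes G :: "'b sgraph" and H :: "'a sgraph" and h :: nat
  assumes G: "simple_graph G" and H: "simple_graph H" and g: "bij_betw g {..<h} (verts H)"
    and z: "inj_on z {..<h}" "z ` {..<h} \<subseteq> verts G"
    and emb: "\<And>u v. u < h \<Longrightarrow> v < h \<Longrightarrow> u < v \<Longrightarrow> {z u, z v} \<in> edges G \<longleftrightarrow> {g u, g v} \<in> edges H"
  shows "\<exists>S\<subseteq>verts G. graph_iso (induced G S) H"
proof -
  let ?S = "z ` {..<h}"
  have nG: "{x} \<notin> edges G" for x using G by (auto simp: simple_graph_def)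
  have nH: "{x} \<notin> edges H" for x using H by (auto simp: simple_graph_def)
  have inv: "inv_into {..<h} z (z u) = u" if "u < h" for u using inv_into_f_f[OF z(1)] that by simp
  have "graph_iso (induced G ?S) H"
    unfolding graph_iso_def
  proof (intro exI[of _ "g \<circ> inv_into {..<h} z"] conjI ballI)
    have "bij_betw (inv_into {..<h} z) ?S {..<h}" using z(1) by (simp add: bij_betw_inv_into inj_on_imp_bij_betw)
    then show "bij_betw (g \<circ> inv_into {..<h} z) (verts (induced G ?S)) (verts H)"
      using g by (simp add: induced_def bij_betw_trans)
  next
    fix a b assume "a \<in> verts (induced G ?S)" "b \<in> verts (induced G ?S)"
    then obtain u v where uv: "u < h" "v < h" "a = z u" "b = z v" by (auto simp: induced_def)
    have "{z u, z v} \<in> edges G \<longleftrightarrow> {g u, g v} \<in> edges H"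
    proof (cases u v rule: linorder_cases)
      case less
      then show ?thesis using emb uv by simp
    next
      case equal
      then show ?thesis using nG nH by simp
    next
      case greater
      then show ?thesis using emb[of v u] uv by (simp add: insert_commute)
    qed
    then show "({a, b} \<in> edges (induced G ?S)) = ({(g \<circ> inv_into {..<h} z) a, (g \<circ> inv_into {..<h} z) b} \<in> edges H)"
      using uv inv by (simp add: induced_def)
  qed
  then show ?thesis using z(2) by blast
qed

lemma card_ordered_pairs_le:
  assumes "finite \<D>"
  shows "card {(x, y). {x, y} \<in> \<D>} \<le> 2 * card \<D>"
proof -
  have pr: "card {(x, y). {x, y} = e} \<le> 2" for e :: "'a set"
  proof (cases "\<exists>a b. e = {a, b}")
    case True
    then obtain a b where "e = {a, b}" by blast
    then have "{(x, y). {x, y} = e} \<subseteq> {(a, b), (b, a)}" by (auto simp: doubleton_eq_iff)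
    then have "card {(x, y). {x, y} = e} \<le> card {(a, b), (b, a)}" by (intro card_mono) auto
    also have "\<dots> \<le> 2" using card_length[of "[(a, b), (b, a)]"] by simp
    finally show ?thesis .
  next
    case False
    then have "{(x, y). {x, y} = e} = {}" by blast
    then show ?thesis by simp
  qed
  have "{(x, y). {x, y} \<in> \<D>} = (\<Union>e\<in>\<D>. {(x, y). {x, y} = e})" by auto
  then have "card {(x, y). {x, y} \<in> \<D>} \<le> (\<Sum>e\<in>\<D>. card {(x, y). {x, y} = e})"
    using card_UN_le[OF assms, of "\<lambda>e. {(x, y). {x, y} = e}"] by simp
  also have "\<dots> \<le> (\<Sum>e\<in>\<D>. 2)" by (rule sum_mono, rule pr)
  finally show ?thesis by simp
qed

text \<open>\<open>Min\<close> and \<open>Max\<close> are informative only on finite nonempty sets;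
  two vertices in \<open>H\<close> guarantee that the family is not empty.\<close>

lemma max_dist_Forb_attained:
  fixes G :: "nat sgraph"
  assumes H: "simple_graph H" "card (verts H) \<ge> 2" and G: "simple_graph G" "card (verts G) = n"
  obtains G' H' where "H' \<in> Forb n H" "simple_graph G'" "graph_iso G' H'" "verts G' = verts G"
    "card (sym_diff (edges G) (edges G')) \<le> max_dist n (Forb n H)"
proof -
  have "family_dist G (Forb n H) \<in> {graph_dist G H' | H'. H' \<in> Forb n H}"
    unfolding family_dist_def
    by (rule Min_in[OF family_dist_finite[OF G]]) (use Forb_nonempty[OF H] in auto)
  then obtain H' where H': "H' \<in> Forb n H" "family_dist G (Forb n H) = graph_dist G H'" by auto
  then have sH': "simple_graph H'" "card (verts G) = card (verts H')" using G by (auto simp: Forb_def)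
  have "graph_dist G H' \<in> {card (sym_diff (edges G) (edges G'')) | G''.
     simple_graph G'' \<and> graph_iso G'' H' \<and> verts G'' = verts G}"
    unfolding graph_dist_def by (rule Min_in[OF graph_dist_finite[OF G(1)] graph_dist_nonempty[OF G(1) sH']])
  then obtain G' where G': "simple_graph G'" "graph_iso G' H'" "verts G' = verts G"
      "graph_dist G H' = card (sym_diff (edges G) (edges G'))" by auto
  have "family_dist G (Forb n H) \<le> max_dist n (Forb n H)"
    unfolding max_dist_def by (rule Max_ge[OF max_dist_finite[OF H]]) (use G in blast)
  then show ?thesis using that[OF H'(1) G'(1-3)] G'(4) H'(2) by simp
qed

text \<open>The quasirandom graph is the witness for the maximum: if its nearest
  \<open>H\<close>-free graph were too close, it would contain an induced copy of
  \<open>H\<close>.\<close>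

lemma max_dist_Forb_lower_bound:
  fixes H :: "'a sgraph" and \<epsilon> :: real
  assumes H: "simple_graph H" and chi: "binary_chromatic_number H = k + 1" and k: "k \<ge> 1"
    and \<epsilon>: "0 < \<epsilon>" "\<epsilon> < 1"
  shows "\<forall>\<^sub>F n in sequentially. real (max_dist n (Forb n H)) \<ge> (1 - \<epsilon>) * ((real n)\<^sup>2 / (4 * real k))"
proof -
  define h where "h = card (verts H)"
  have finH: "finite (verts H)" using H by (simp add: simple_graph_def)
  \<comment> \<open>Singletons give a partition into any mixture of \<open>card (verts H)\<close>
    parts, so the binary chromatic number is at most the order of \<open>H\<close>.\<close>
  have h2: "card (verts H) \<ge> 2"
  proof -
    have "binary_chromatic_number H \<le> card (verts H)"
      unfolding binary_chromatic_number_def by (rule Least_le) (rule binary_chromatic_number_exists[OF H])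
    then show ?thesis using chi k by simp
  qed
  have "\<forall>c\<in>{0..binary_chromatic_number H}. clique_coclique_partition H c (binary_chromatic_number H - c)"
    unfolding binary_chromatic_number_def by (rule LeastI) (rule binary_chromatic_number_exists[OF H])
  then have part: "\<forall>c\<in>{0..Suc k}. clique_coclique_partition H c (Suc k - c)" unfolding chi by simp
  obtain g where g: "bij_betw g {..<h} (verts H)"
    using ex_bij_betw_nat_finite[OF finH] by (auto simp: h_def atLeast0LessThan)
  define EH where "EH = (\<lambda>u v. {g u, g v} \<in> edges H)"
  have col: "binary_colourable h EH (Suc k)"
    unfolding EH_def by (rule binary_colourable_of_partitions[OF g part])
  obtain \<gamma> N where \<gamma>: "\<gamma> > 0" and N: "\<forall>(V :: nat set) E E'. finite V \<longrightarrow> card V \<ge> N \<longrightarrow> symp E' \<longrightarrow>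
     (\<forall>S\<subseteq>V. \<forall>T\<subseteq>V. \<bar>\<Sum>x\<in>S. \<Sum>y\<in>T. (if E x y then 1 else 0) - 1 / 2\<bar> \<le> \<gamma> * (real (card V))\<^sup>2) \<longrightarrow>
     real (card {(x, y) \<in> V \<times> V. E x y \<noteq> E' x y}) \<le> (1 - \<epsilon>) * (real (card V))\<^sup>2 / (2 * real k) \<longrightarrow>
     (\<exists>z. inj_on z {..<h} \<and> z ` {..<h} \<subseteq> V \<and> (\<forall>u<h. \<forall>v<h. u < v \<longrightarrow> E' (z u) (z v) = EH u v))"
    using induced_copy_near_quasirandom[where 'v = nat, OF col k \<epsilon>] by (elim exE conjE)
  have bound: "real (max_dist n (Forb n H)) \<ge> (1 - \<epsilon>) * ((real n)\<^sup>2 / (4 * real k))"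
    if n: "n \<ge> N" "real n \<ge> 2 / \<gamma>\<^sup>2" "real n \<ge> 2 / \<gamma>" "n \<ge> 1" for n
  proof (rule ccontr)
    assume "\<not> ?thesis"
    then have small: "real (max_dist n (Forb n H)) < (1 - \<epsilon>) * ((real n)\<^sup>2 / (4 * real k))" by simp
    from ex_quasirandom_graph[OF \<gamma> n(2-4)] obtain E :: "nat \<Rightarrow> nat \<Rightarrow> bool" where E: "symp E" "irreflp E"
      and disc: "\<forall>S\<subseteq>{..<n}. \<forall>T\<subseteq>{..<n}. \<bar>\<Sum>x\<in>S. \<Sum>y\<in>T. (if E x y then 1 else 0) - 1 / 2\<bar> \<le> \<gamma> * (real n)\<^sup>2"
      by (elim exE conjE)
    define G where "G = \<lparr>verts = {..<n}, edges = {{x, y} | x y. x < n \<and> y < n \<and> E x y}\<rparr>"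
    have G: "simple_graph G" "card (verts G) = n"
    proof -
      have "card {x, y} = 2" if "E x y" for x y using E(2) that by (auto simp: card_insert_if irreflp_def)
      then show "simple_graph G" "card (verts G) = n" by (auto simp: simple_graph_def G_def)
    qed
    have GE: "{x, y} \<in> edges G \<longleftrightarrow> E x y" if "x < n" "y < n" for x y
      using that sympD[OF E(1)] by (auto simp: G_def doubleton_eq_iff)
    obtain G' H' where H': "H' \<in> Forb n H" and G': "simple_graph G'" "graph_iso G' H'" "verts G' = verts G"
      and d: "card (sym_diff (edges G) (edges G')) \<le> max_dist n (Forb n H)"
      using max_dist_Forb_attained[OF H h2 G] by blast
    define E' where "E' = (\<lambda>x y. {x, y} \<in> edges G')"
    have symE': "symp E'" by (auto simp: E'_def symp_def insert_commute)
    have "card {(x, y) \<in> {..<n} \<times> {..<n}. E x y \<noteq> E' x y} \<le> card {(x, y). {x, y} \<in> sym_diff (edges G) (edges G')}"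
    proof (rule card_mono)
      have "{(x, y). {x, y} \<in> sym_diff (edges G) (edges G')} \<subseteq> {..<n} \<times> {..<n}"
        using G(1) G'(1,3) by (auto simp: simple_graph_def G_def)
      then show "finite {(x, y). {x, y} \<in> sym_diff (edges G) (edges G')}" by (rule finite_subset) simp
      show "{(x, y) \<in> {..<n} \<times> {..<n}. E x y \<noteq> E' x y} \<subseteq> {(x, y). {x, y} \<in> sym_diff (edges G) (edges G')}"
        using GE by (auto simp: E'_def)
    qed
    also have "\<dots> \<le> 2 * card (sym_diff (edges G) (edges G'))"
    proof (rule card_ordered_pairs_le)
      have "sym_diff (edges G) (edges G') \<subseteq> Pow {..<n}"
        using G(1) G'(1,3) by (auto simp: simple_graph_def G_def)
      then show "finite (sym_diff (edges G) (edges G'))" by (rule finite_subset) simp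
    qed
    finally have "real (card {(x, y) \<in> {..<n} \<times> {..<n}. E x y \<noteq> E' x y}) \<le> 2 * real (max_dist n (Forb n H))"
      using d by linarith
    \<comment> \<open>Counting ordered pairs doubles the number of edits, which turns 4k into
      2k.\<close>
    also have "\<dots> \<le> (1 - \<epsilon>) * (real n)\<^sup>2 / (2 * real k)" using small by (simp add: field_simps)
    finally have edits: "real (card {(x, y) \<in> {..<n} \<times> {..<n}. E x y \<noteq> E' x y}) \<le> (1 - \<epsilon>) * (real (card {..<n}))\<^sup>2 / (2 * real k)"
      by simp
    have disc': "\<forall>S\<subseteq>{..<n}. \<forall>T\<subseteq>{..<n}. \<bar>\<Sum>x\<in>S. \<Sum>y\<in>T. (if E x y then 1 else 0) - 1 / 2\<bar> \<le> \<gamma> * (real (card {..<n}))\<^sup>2"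
      using disc by (simp only: card_lessThan)
    from N[THEN spec, of "{..<n}", THEN spec, of E, THEN spec, of E', THEN mp, THEN mp, THEN mp, THEN mp, THEN mp,
        OF finite_lessThan _ symE' disc' edits] n(1)
    obtain z where z: "inj_on z {..<h}" "z ` {..<h} \<subseteq> {..<n}" and zE: "\<forall>u<h. \<forall>v<h. u < v \<longrightarrow> E' (z u) (z v) = EH u v"
      by auto
    obtain f where f: "bij_betw f (verts G') (verts H')"
      and fE: "\<forall>u\<in>verts G'. \<forall>v\<in>verts G'. {u, v} \<in> edges G' \<longleftrightarrow> {f u, f v} \<in> edges H'"
      using G'(2) unfolding graph_iso_def by blast
    have zV: "z u \<in> verts G'" if "u < h" for u using z(2) that G'(3) by (auto simp: G_def)
    \<comment> \<open>The copy found in \<open>G'\<close> is carried along the isomorphism to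
      \<open>H'\<close>, the member of the family.\<close>
    have "\<exists>S\<subseteq>verts H'. graph_iso (induced H' S) H"
    proof (rule induced_copy_of_embedding[OF _ H g, of _ "f \<circ> z"])
      show "simple_graph H'" using H' by (simp add: Forb_def)
      have sub: "z ` {..<h} \<subseteq> verts G'" using zV by auto
      show "inj_on (f \<circ> z) {..<h}"
        using z(1) f sub by (meson bij_betw_def comp_inj_on inj_on_subset)
      show "(f \<circ> z) ` {..<h} \<subseteq> verts H'" using zV f by (auto simp: bij_betw_def)
      fix u v assume uv: "u < h" "v < h" "u < v"
      then have "({z u, z v} \<in> edges G') = ({g u, g v} \<in> edges H)" using zE by (simp add: E'_def EH_def)
      then show "({(f \<circ> z) u, (f \<circ> z) v} \<in> edges H') = ({g u, g v} \<in> edges H)"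
        using fE zV[OF uv(1)] zV[OF uv(2)] by simp
    qed
    then show False using H' by (auto simp: Forb_def)
  qed
  have ev: "\<forall>\<^sub>F n in sequentially. real n \<ge> C" for C
    using filterlim_real_sequentially by (simp add: filterlim_at_top)
  show ?thesis
    using eventually_ge_at_top[of N] ev[of "2 / \<gamma>\<^sup>2"] ev[of "2 / \<gamma>"] eventually_ge_at_top[of 1]
    by eventually_elim (rule bound)
qed

theorem theorem1p2:
  fixes H :: "'a sgraph" and k :: nat
  assumes "simple_graph H"
    and "binary_chromatic_number H = k + 1"
    and "k \<ge> 1"
  shows "\<exists>\<epsilon> :: nat \<Rightarrow> real. \<epsilon> \<in> o(\<lambda>_. 1) \<and>
    (\<forall>\<^sub>F n in sequentially.
       real (max_dist n (Forb n H)) > (1 - \<epsilon> n) * ((real n)\<^sup>2 / (4 * real k)))"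
proof -
  define Q where "Q = (\<lambda>n. (real n)\<^sup>2 / (4 * real k))"
  define md where "md = (\<lambda>n. real (max_dist n (Forb n H)))"
  \<comment> \<open>The actual deficit, cut off at 0, is the least error that works; the term 1/(n +
    1) makes the inequality strict. This merges the bounds for all fixed errors into a single null
    sequence.\<close>
  define \<epsilon> where "\<epsilon> = (\<lambda>n. max 0 (1 - md n / Q n) + 1 / real (Suc n))"
  have Q: "Q n > 0" if "n \<ge> 1" for n using that assms(3) by (simp add: Q_def)
  have "(\<lambda>n. max 0 (1 - md n / Q n)) \<longlonglongrightarrow> 0"
  proof (rule tendstoI)
    fix e :: real assume "e > 0"
    \<comment> \<open>Half of the minimum with 1 stays strictly below both \<open>e\<close> and 1,
      as the bound for fixed errors requires an error less than 1.\<close>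
    define e' where "e' = min e 1 / 2"
    have e': "0 < e'" "e' < 1" "e' < e" using \<open>e > 0\<close> by (auto simp: e'_def min_def)
    show "\<forall>\<^sub>F n in sequentially. dist (max 0 (1 - md n / Q n)) 0 < e"
      using max_dist_Forb_lower_bound[OF assms e'(1,2)] eventually_ge_at_top[of 1]
    proof eventually_elim
      case (elim n)
      have "(1 - e') * Q n \<le> md n" using elim(1) by (simp only: md_def Q_def)
      then have "1 - e' \<le> md n / Q n" using Q[OF elim(2)] by (simp add: pos_le_divide_eq)
      then show ?case using e' \<open>e > 0\<close> by (simp add: dist_real_def)
    qed
  qed
  from tendsto_add[OF this LIMSEQ_Suc[OF lim_1_over_n]] have "\<epsilon> \<longlonglongrightarrow> 0" by (simp add: \<epsilon>_def)
  then have "\<epsilon> \<in> o(\<lambda>_. 1)" by (simp add: smalloI_tendsto)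
  moreover have "\<forall>\<^sub>F n in sequentially. md n > (1 - \<epsilon> n) * Q n"
    using eventually_ge_at_top[of 1]
  proof eventually_elim
    case (elim n)
    have "0 < 1 / real (Suc n)" "1 - md n / Q n \<le> max 0 (1 - md n / Q n)" by simp_all
    then have "1 - \<epsilon> n < md n / Q n" unfolding \<epsilon>_def by linarith
    then show ?case using Q[OF elim] by (simp add: pos_less_divide_eq)
  qed
  ultimately show ?thesis unfolding md_def Q_def by blast
qed

end
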